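(* Let $H$ be an $\varepsilon$-Hopf algebra which is a Fréchet space. Let $\chi(H)$ be the set of characters of $H$ (continuous unital multiplicative linear functionals $H\to\mathbb{K}$), which is a group under convolution $\varphi*\psi=(\varphi\overline{\otimes}_\varepsilon\psi)\Delta$ with neutral element the counit and inverse $\omega\mapsto\omega\circ S$. Let $\chi_c(H)$ denote $\chi(H)$ with the topology of uniform convergence on precompact subsets of $H$. Then $\chi_c(H)$ is a topological group, and it is complete as a subspace of the uniform space $H'_c$. If moreover $\mathbb{K}=\mathbb{C}$ and $H$ is an $\varepsilon$-Hopf-$*$ algebra, then the set $\chi^{\mathrm{inv}}_c(H)$ of involutive characters ($\omega(x^* )=\overline{\omega(x)}$) is a closed subgroup of $\chi_c(H)$.
   Context: An $\varepsilon$-Hopf algebra is a complete locally convex space $H$ with continuous linear multiplication $m:H\overline{\otimes}_\varepsilon H\to H$, unit, comultiplication $\Delta:H\to H\overline{\otimes}_\varepsilon H$, counit and antipode $S$ satisfying the Hopf algebra axioms, $\overline{\otimes}_\varepsilon$ being the completed injective tensor product; an $\varepsilon$-Hopf-$*$ algebra ($\mathbb{K}=\mathbb{C}$) additionally has an antilinear homeomorphic anti-multiplicative involution of order two preserved by $\Delta$. $H'_c$ is the dual $H'$ with the uniform structure of uniform convergence on precompact subsets of $H$. *)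

theory Defs
  imports "HOL-Analysis.Analysis"
begin

text \<open>A locally convex space is given by a carrier type with addition (class ab_group_add),
  a scalar multiplication sm by a field of scalars (real or complex: every real_normed_field
  is one of these) and a countable family of seminorms P.  We use the cofinal increasing
  family of seminorms qsn P N = sum of P n for n up to N.\<close>

definition module_ax :: "('k::field \<Rightarrow> 'v::ab_group_add \<Rightarrow> 'v) \<Rightarrow> bool" where
  "module_ax sm \<longleftrightarrow> (\<forall>a x y. sm a (x + y) = sm a x + sm a y)
     \<and> (\<forall>a b x. sm (a + b) x = sm a x + sm b x)
     \<and> (\<forall>a b x. sm a (sm b x) = sm (a * b) x) \<and> (\<forall>x. sm 1 x = x)"

definition seminorm_on :: "('k::real_normed_field \<Rightarrow> 'v::ab_group_add \<Rightarrow> 'v) \<Rightarrow> ('v \<Rightarrow> real) \<Rightarrow> bool" where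
  "seminorm_on sm p \<longleftrightarrow> (\<forall>x y. p (x + y) \<le> p x + p y) \<and> (\<forall>a x. p (sm a x) = norm a * p x)"

definition qsn :: "(nat \<Rightarrow> 'v \<Rightarrow> real) \<Rightarrow> nat \<Rightarrow> 'v \<Rightarrow> real" where
  "qsn P N x = (\<Sum>n\<le>N. P n x)"

definition lcs_converges :: "(nat \<Rightarrow> 'v::ab_group_add \<Rightarrow> real) \<Rightarrow> (nat \<Rightarrow> 'v) \<Rightarrow> 'v \<Rightarrow> bool" where
  "lcs_converges P s w \<longleftrightarrow> (\<forall>N. (\<lambda>k. qsn P N (s k - w)) \<longlonglongrightarrow> 0)"

definition lcs_cauchy :: "(nat \<Rightarrow> 'v::ab_group_add \<Rightarrow> real) \<Rightarrow> (nat \<Rightarrow> 'v) \<Rightarrow> bool" where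
  "lcs_cauchy P s \<longleftrightarrow> (\<forall>N e. e > 0 \<longrightarrow> (\<exists>K. \<forall>i\<ge>K. \<forall>j\<ge>K. qsn P N (s i - s j) < e))"

definition frechet :: "('k::real_normed_field \<Rightarrow> 'v::ab_group_add \<Rightarrow> 'v) \<Rightarrow> (nat \<Rightarrow> 'v \<Rightarrow> real) \<Rightarrow> bool" where
  "frechet sm P \<longleftrightarrow> module_ax sm \<and> (\<forall>n. seminorm_on sm (P n))
     \<and> (\<forall>x. x \<noteq> 0 \<longrightarrow> (\<exists>n. P n x \<noteq> 0))
     \<and> (\<forall>s. lcs_cauchy P s \<longrightarrow> (\<exists>w. lcs_converges P s w))"

definition klinear :: "('k::field \<Rightarrow> 'v::ab_group_add \<Rightarrow> 'v) \<Rightarrow> ('v \<Rightarrow> 'k) \<Rightarrow> bool" where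
  "klinear sm f \<longleftrightarrow> (\<forall>x y. f (x + y) = f x + f y) \<and> (\<forall>a x. f (sm a x) = a * f x)"

definition dual :: "('k::real_normed_field \<Rightarrow> 'v::ab_group_add \<Rightarrow> 'v) \<Rightarrow> (nat \<Rightarrow> 'v \<Rightarrow> real) \<Rightarrow> ('v \<Rightarrow> 'k) set" where
  "dual sm P = {f. klinear sm f \<and> (\<exists>N C. \<forall>x. norm (f x) \<le> C * qsn P N x)}"

text \<open>Polar of the unit ball of qsn P N (an equicontinuous set; these are cofinal).\<close>
definition polar :: "('k::real_normed_field \<Rightarrow> 'v::ab_group_add \<Rightarrow> 'v) \<Rightarrow> (nat \<Rightarrow> 'v \<Rightarrow> real) \<Rightarrow> nat \<Rightarrow> ('v \<Rightarrow> 'k) set" where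
  "polar sm P N = {f \<in> dual sm P. \<forall>x. norm (f x) \<le> qsn P N x}"

definition cont_lin_op :: "('k::real_normed_field \<Rightarrow> 'v::ab_group_add \<Rightarrow> 'v) \<Rightarrow> (nat \<Rightarrow> 'v \<Rightarrow> real) \<Rightarrow> ('v \<Rightarrow> 'v) \<Rightarrow> bool" where
  "cont_lin_op sm P T \<longleftrightarrow> (\<forall>x y. T (x + y) = T x + T y) \<and> (\<forall>a x. T (sm a x) = sm a (T x))
     \<and> (\<forall>M. \<exists>N C. \<forall>x. qsn P M (T x) \<le> C * qsn P N x)"

text \<open>Completed injective tensor product H \<otimes>_eps H, realised (for complete H) as the closure
  of the algebraic tensor product inside the bilinear forms on H' \<times> H', with the
  eps-topology of uniform convergence on products of equicontinuous sets (polars).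
  A finite tensor sum of x_i \<otimes> y_i is given by a list of pairs.\<close>

type_synonym ('k, 'v) bform = "('v \<Rightarrow> 'k) \<Rightarrow> ('v \<Rightarrow> 'k) \<Rightarrow> 'k"

definition tens :: "('k::real_normed_field \<Rightarrow> 'v::ab_group_add \<Rightarrow> 'v) \<Rightarrow> (nat \<Rightarrow> 'v \<Rightarrow> real) \<Rightarrow> ('v \<times> 'v) list \<Rightarrow> ('k, 'v) bform" where
  "tens sm P t = (\<lambda>f g. if f \<in> dual sm P \<and> g \<in> dual sm P then (\<Sum>(x, y)\<leftarrow>t. f x * g y) else 0)"

definition eps_norm :: "('k::real_normed_field \<Rightarrow> 'v::ab_group_add \<Rightarrow> 'v) \<Rightarrow> (nat \<Rightarrow> 'v \<Rightarrow> real) \<Rightarrow> nat \<Rightarrow> ('k, 'v) bform \<Rightarrow> real" where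
  "eps_norm sm P N B = Sup {norm (B f g) | f g. f \<in> polar sm P N \<and> g \<in> polar sm P N}"

definition eps_approx :: "('k::real_normed_field \<Rightarrow> 'v::ab_group_add \<Rightarrow> 'v) \<Rightarrow> (nat \<Rightarrow> 'v \<Rightarrow> real) \<Rightarrow> (nat \<Rightarrow> ('v \<times> 'v) list) \<Rightarrow> ('k, 'v) bform \<Rightarrow> bool" where
  "eps_approx sm P ts B \<longleftrightarrow> (\<forall>N e. e > 0 \<longrightarrow> (\<exists>K. \<forall>k\<ge>K. \<forall>f\<in>polar sm P N. \<forall>g\<in>polar sm P N.
      norm (B f g - tens sm P (ts k) f g) \<le> e))"

definition ctens :: "('k::real_normed_field \<Rightarrow> 'v::ab_group_add \<Rightarrow> 'v) \<Rightarrow> (nat \<Rightarrow> 'v \<Rightarrow> real) \<Rightarrow> ('k, 'v) bform set" where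
  "ctens sm P = {B. (\<forall>f g. f \<notin> dual sm P \<or> g \<notin> dual sm P \<longrightarrow> B f g = 0) \<and> (\<exists>ts. eps_approx sm P ts B)}"

text \<open>Value at B of the continuous extension to H \<otimes>_eps H of the functional
  x \<otimes> y \<mapsto> Phi x y.\<close>
definition ext_eval :: "('k::real_normed_field \<Rightarrow> 'v::ab_group_add \<Rightarrow> 'v) \<Rightarrow> (nat \<Rightarrow> 'v \<Rightarrow> real) \<Rightarrow> ('v \<Rightarrow> 'v \<Rightarrow> 'k) \<Rightarrow> ('k, 'v) bform \<Rightarrow> 'k" where
  "ext_eval sm P Phi B = (THE w. \<exists>ts. eps_approx sm P ts B \<and> (\<lambda>k. \<Sum>(x, y)\<leftarrow>ts k. Phi x y) \<longlonglongrightarrow> w)"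

text \<open>eps-Hopf algebra structure on a Frechet space: multiplication mu (given by its values
  on elementary tensors, with the continuity estimate on H \<otimes>_eps H), unit one,
  comultiplication Delta : H \<rightarrow> H \<otimes>_eps H, counit, antipode S.\<close>
definition eps_hopf_frechet ::
  "('k::real_normed_field \<Rightarrow> 'v::ab_group_add \<Rightarrow> 'v) \<Rightarrow> (nat \<Rightarrow> 'v \<Rightarrow> real) \<Rightarrow> ('v \<Rightarrow> 'v \<Rightarrow> 'v) \<Rightarrow> 'v
    \<Rightarrow> ('v \<Rightarrow> ('k, 'v) bform) \<Rightarrow> ('v \<Rightarrow> 'k) \<Rightarrow> ('v \<Rightarrow> 'v) \<Rightarrow> bool" where
  "eps_hopf_frechet sm P mu one Delta counit S \<longleftrightarrow>
     frechet sm P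
     \<comment> \<open>algebra\<close>
     \<and> (\<forall>x y z. mu (x + y) z = mu x z + mu y z) \<and> (\<forall>x y z. mu x (y + z) = mu x y + mu x z)
     \<and> (\<forall>a x y. mu (sm a x) y = sm a (mu x y)) \<and> (\<forall>a x y. mu x (sm a y) = sm a (mu x y))
     \<and> (\<forall>M. \<exists>N C. \<forall>t. qsn P M (\<Sum>(x, y)\<leftarrow>t. mu x y) \<le> C * eps_norm sm P N (tens sm P t))
     \<and> (\<forall>x y z. mu (mu x y) z = mu x (mu y z))
     \<and> (\<forall>x. mu one x = x \<and> mu x one = x)
     \<comment> \<open>coalgebra\<close>
     \<and> (\<forall>x. Delta x \<in> ctens sm P)
     \<and> (\<forall>x y f g. Delta (x + y) f g = Delta x f g + Delta y f g)
     \<and> (\<forall>a x f g. Delta (sm a x) f g = a * Delta x f g)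
     \<and> (\<forall>N. \<exists>M C. \<forall>x. eps_norm sm P N (Delta x) \<le> C * qsn P M x)
     \<and> (\<forall>x. \<forall>f\<in>dual sm P. \<forall>g\<in>dual sm P. \<forall>h\<in>dual sm P.
           Delta x (\<lambda>y. Delta y f g) h = Delta x f (\<lambda>y. Delta y g h))
     \<and> counit \<in> dual sm P
     \<and> (\<forall>x. \<forall>h\<in>dual sm P. Delta x counit h = h x \<and> Delta x h counit = h x)
     \<comment> \<open>bialgebra compatibility\<close>
     \<and> counit one = 1 \<and> (\<forall>x y. counit (mu x y) = counit x * counit y)
     \<and> (\<forall>f\<in>dual sm P. \<forall>g\<in>dual sm P. Delta one f g = f one * g one)
     \<and> (\<forall>x y. \<forall>f\<in>dual sm P. \<forall>g\<in>dual sm P.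
           Delta (mu x y) f g = ext_eval sm P (\<lambda>a b. Delta y (\<lambda>c. f (mu a c)) (\<lambda>d. g (mu b d))) (Delta x))
     \<comment> \<open>antipode\<close>
     \<and> cont_lin_op sm P S
     \<and> (\<forall>x. \<forall>h\<in>dual sm P. ext_eval sm P (\<lambda>a b. h (mu (S a) b)) (Delta x) = counit x * h one
                          \<and> ext_eval sm P (\<lambda>a b. h (mu a (S b))) (Delta x) = counit x * h one)"

definition eps_hopf_star_frechet ::
  "(complex \<Rightarrow> 'v::ab_group_add \<Rightarrow> 'v) \<Rightarrow> (nat \<Rightarrow> 'v \<Rightarrow> real) \<Rightarrow> ('v \<Rightarrow> 'v \<Rightarrow> 'v) \<Rightarrow> 'v
    \<Rightarrow> ('v \<Rightarrow> (complex, 'v) bform) \<Rightarrow> ('v \<Rightarrow> complex) \<Rightarrow> ('v \<Rightarrow> 'v) \<Rightarrow> ('v \<Rightarrow> 'v) \<Rightarrow> bool" where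
  "eps_hopf_star_frechet sm P mu one Delta counit S star \<longleftrightarrow>
     eps_hopf_frechet sm P mu one Delta counit S
     \<and> (\<forall>x y. star (x + y) = star x + star y) \<and> (\<forall>a x. star (sm a x) = sm (cnj a) (star x))
     \<and> (\<forall>x. star (star x) = x) \<and> (\<forall>x y. star (mu x y) = mu (star y) (star x))
     \<and> (\<forall>M. \<exists>N C. \<forall>x. qsn P M (star x) \<le> C * qsn P N x)
     \<and> (\<forall>x. \<forall>f\<in>dual sm P. \<forall>g\<in>dual sm P.
           Delta (star x) f g = cnj (Delta x (\<lambda>a. cnj (f (star a))) (\<lambda>b. cnj (g (star b)))))"

definition characters :: "('k::real_normed_field \<Rightarrow> 'v::ab_group_add \<Rightarrow> 'v) \<Rightarrow> (nat \<Rightarrow> 'v \<Rightarrow> real) \<Rightarrow> ('v \<Rightarrow> 'v \<Rightarrow> 'v) \<Rightarrow> 'v \<Rightarrow> ('v \<Rightarrow> 'k) set" where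
  "characters sm P mu one = {w \<in> dual sm P. w one = 1 \<and> (\<forall>x y. w (mu x y) = w x * w y)}"

definition inv_characters :: "(complex \<Rightarrow> 'v::ab_group_add \<Rightarrow> 'v) \<Rightarrow> (nat \<Rightarrow> 'v \<Rightarrow> real) \<Rightarrow> ('v \<Rightarrow> 'v \<Rightarrow> 'v) \<Rightarrow> 'v \<Rightarrow> ('v \<Rightarrow> 'v) \<Rightarrow> ('v \<Rightarrow> complex) set" where
  "inv_characters sm P mu one star = {w \<in> characters sm P mu one. \<forall>x. w (star x) = cnj (w x)}"

definition conv :: "('v \<Rightarrow> ('k, 'v) bform) \<Rightarrow> ('v \<Rightarrow> 'k) \<Rightarrow> ('v \<Rightarrow> 'k) \<Rightarrow> ('v \<Rightarrow> 'k)" where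
  "conv Delta phi psi = (\<lambda>x. Delta x phi psi)"

definition precompact_lcs :: "(nat \<Rightarrow> 'v::ab_group_add \<Rightarrow> real) \<Rightarrow> 'v set \<Rightarrow> bool" where
  "precompact_lcs P K \<longleftrightarrow> (\<forall>N e. e > 0 \<longrightarrow>
      (\<exists>F. finite F \<and> K \<subseteq> (\<Union>x\<in>F. {y. qsn P N (y - x) < e})))"

definition ucp_topology :: "(nat \<Rightarrow> 'v::ab_group_add \<Rightarrow> real) \<Rightarrow> ('v \<Rightarrow> 'k::real_normed_field) topology" where
  "ucp_topology P = topology (\<lambda>U. \<forall>f\<in>U. \<exists>K e. precompact_lcs P K \<and> e > 0
      \<and> {g. \<forall>x\<in>K. norm (g x - f x) < e} \<subseteq> U)"

definition ucp_cauchy :: "(nat \<Rightarrow> 'v::ab_group_add \<Rightarrow> real) \<Rightarrow> ('v \<Rightarrow> 'k::real_normed_field) filter \<Rightarrow> bool" where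
  "ucp_cauchy P F \<longleftrightarrow> (\<forall>K e. precompact_lcs P K \<and> e > 0 \<longrightarrow>
      (\<exists>A. eventually (\<lambda>f. f \<in> A) F \<and> (\<forall>f\<in>A. \<forall>g\<in>A. \<forall>x\<in>K. norm (f x - g x) < e)))"

definition ucp_converges :: "(nat \<Rightarrow> 'v::ab_group_add \<Rightarrow> real) \<Rightarrow> ('v \<Rightarrow> 'k::real_normed_field) filter \<Rightarrow> ('v \<Rightarrow> 'k) \<Rightarrow> bool" where
  "ucp_converges P F w \<longleftrightarrow> (\<forall>K e. precompact_lcs P K \<and> e > 0 \<longrightarrow>
      eventually (\<lambda>f. \<forall>x\<in>K. norm (f x - w x) < e) F)"

definition ucp_complete_subset :: "(nat \<Rightarrow> 'v::ab_group_add \<Rightarrow> real) \<Rightarrow> ('v \<Rightarrow> 'k::real_normed_field) set \<Rightarrow> bool" where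
  "ucp_complete_subset P A \<longleftrightarrow> (\<forall>F. F \<noteq> bot \<and> eventually (\<lambda>f. f \<in> A) F \<and> ucp_cauchy P F
      \<longrightarrow> (\<exists>w\<in>A. ucp_converges P F w))"

definition topological_group_on :: "'a topology \<Rightarrow> ('a \<Rightarrow> 'a \<Rightarrow> 'a) \<Rightarrow> 'a \<Rightarrow> ('a \<Rightarrow> 'a) \<Rightarrow> bool" where
  "topological_group_on T m e i \<longleftrightarrow>
     (\<forall>x\<in>topspace T. \<forall>y\<in>topspace T. m x y \<in> topspace T) \<and> e \<in> topspace T
     \<and> (\<forall>x\<in>topspace T. i x \<in> topspace T)
     \<and> (\<forall>x\<in>topspace T. \<forall>y\<in>topspace T. \<forall>z\<in>topspace T. m (m x y) z = m x (m y z))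
     \<and> (\<forall>x\<in>topspace T. m e x = x \<and> m x e = x)
     \<and> (\<forall>x\<in>topspace T. m (i x) x = e \<and> m x (i x) = e)
     \<and> continuous_map (prod_topology T T) T (\<lambda>(x, y). m x y)
     \<and> continuous_map T T i"

definition closed_subgroup_of :: "'a topology \<Rightarrow> ('a \<Rightarrow> 'a \<Rightarrow> 'a) \<Rightarrow> 'a \<Rightarrow> ('a \<Rightarrow> 'a) \<Rightarrow> 'a set \<Rightarrow> bool" where
  "closed_subgroup_of T m e i A \<longleftrightarrow> A \<subseteq> topspace T \<and> e \<in> A
     \<and> (\<forall>x\<in>A. \<forall>y\<in>A. m x y \<in> A) \<and> (\<forall>x\<in>A. i x \<in> A) \<and> closedin T A"

end

theory Submission
  imports Defs
begin

text \<open>Writing \<open>f * g\<close> for the convolution of continuous functionals, the inverse \<open>r\<close> of a character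
  \<open>w\<close> is multiplicative because \<open>r(a -) * w = r(a) counit\<close> and \<open>w * r = counit\<close>, so convolving with \<open>r\<close>
  gives \<open>r(a -) = r(a) r\<close>.

  For the joint continuity of the convolution, a Banach--Dieudonne argument for the Frechet space \<open>H\<close>
  shows that a neighbourhood in \<open>H'\<^sub>c \<times> H'\<^sub>c\<close> only has to be tested on products of polars.  There
  \<open>(f, g) \<mapsto> Delta x f g\<close> is a uniform limit of finite tensors, hence weak-* continuous, and this
  holds uniformly for \<open>x\<close> in a precompact set because \<open>Delta\<close> is continuous.

  A Cauchy filter of characters converges pointwise to a multiplicative functional, which is bounded on
  null sequences and therefore continuous because \<open>H\<close> is metrizable.\<close>

text \<open>The scalars form an arbitrary \<open>real_normed_field\<close>, not assumed complete;
  compactness of their closed balls stands in for completeness and makes equicontinuous sets compact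
  for pointwise convergence. The main obstacle is joint continuity of convolution: the estimates for
  \<open>Delta\<close> control it only on products of equicontinuous sets, whereas neighbourhoods in
  the dual contain functionals of unbounded size. Since countably many seminorms suffice, a sequence
  of equicontinuous sets exhausts the dual; passing from one to the next costs only finitely many
  further test vectors, and these form a null sequence, hence a single precompact set that works for
  all functionals. The argument runs on the product of two duals, with the base point
  \<open>(f, g)\<close> translated to zero. A second difficulty is that an element of
  \<open>ctens\<close> is a mere function of two functionals, approximated by tensors on polars
  only, so bilinearity of \<open>Delta x\<close> has to be recovered before convolutions and
  inverses of characters can be shown multiplicative.\<close>

section \<open>Local compactness of the scalars\<close>

text \<open>An elementary form of Mazur's theorem that the real and the complex numbers are the only real
  normed fields.  Let \<open>m\<^sup>2\<close> be the minimal norm of a monic real quadratic polynomial at \<open>x\<close>, attained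
  at \<open>y\<close>.  If \<open>m > 0\<close>, then real shifts of \<open>y\<close> by less than \<open>m\<^sup>2\<close> do not change the norm, hence no
  real shift at all does, which is absurd.\<close>
definition quad_bounded_below :: "'k::real_normed_field \<Rightarrow> real \<Rightarrow> bool" where
  "quad_bounded_below x m \<longleftrightarrow> (\<forall>c d. m\<^sup>2 \<le> norm (x\<^sup>2 + of_real c * x + of_real d))"

text \<open>The square of a linear polynomial is itself a monic quadratic, so the bound on
  quadratics has a square root.\<close>

lemma quad_bounded_below_linear:
  assumes "quad_bounded_below x m" "0 \<le> m"
  shows "m \<le> norm (x + of_real s)"
proof -
  have "m\<^sup>2 \<le> norm (x\<^sup>2 + of_real (2 * s) * x + of_real (s\<^sup>2))"
    using assms unfolding quad_bounded_below_def by blast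
  also have "x\<^sup>2 + of_real (2 * s) * x + of_real (s\<^sup>2) = (x + of_real s)\<^sup>2"
    by (simp add: power2_eq_square algebra_simps)
  finally show ?thesis
    using assms by (simp add: norm_power)
qed

lemma quad_bounded_below_translate:
  assumes "quad_bounded_below x m"
  shows "quad_bounded_below (x + of_real s) m"
  unfolding quad_bounded_below_def
proof (intro allI)
  fix c d
  have "(x + of_real s)\<^sup>2 + of_real c * (x + of_real s) + of_real d
      = x\<^sup>2 + of_real (2 * s + c) * x + of_real (s\<^sup>2 + c * s + d)"
    by (simp add: power2_eq_square algebra_simps)
  then show "m\<^sup>2 \<le> norm ((x + of_real s)\<^sup>2 + of_real c * (x + of_real s) + of_real d)"
    using assms unfolding quad_bounded_below_def by metis
qed

text \<open>A nonnegative discriminant allows factoring as a quadratic in \<open>x\<^sup>2\<close>.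
  Otherwise \<open>d > 0\<close>, and completing the square the other way gives the difference of
  squares \<open>(x\<^sup>2 + g)\<^sup>2 - (h * x)\<^sup>2\<close> with
  \<open>g = sqrt d\<close>.\<close>

lemma biquadratic_factorization:
  fixes c d :: real
  obtains p q r s where "\<And>x::'k::real_normed_field. x^4 + of_real c * x\<^sup>2 + of_real d
      = (x\<^sup>2 + of_real p * x + of_real q) * (x\<^sup>2 + of_real r * x + of_real s)"
proof (cases "c\<^sup>2 - 4*d \<ge> 0")
  case True
  define w where "w = sqrt (c\<^sup>2 - 4*d)"
  have w: "w\<^sup>2 = c\<^sup>2 - 4*d" using True by (simp add: w_def)
  have e: "((c-w)/2) + ((c+w)/2) = c" "((c-w)/2) * ((c+w)/2) = d"
    using w by (auto simp: field_simps power2_eq_square)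
  have "x^4 + of_real c * x\<^sup>2 + of_real d
      = (x\<^sup>2 + of_real 0 * x + of_real ((c-w)/2)) * (x\<^sup>2 + of_real 0 * x + of_real ((c+w)/2))"
    for x :: 'k
  proof -
    have "(x\<^sup>2 + of_real ((c-w)/2)) * (x\<^sup>2 + of_real ((c+w)/2))
      = x^4 + of_real (((c-w)/2) + ((c+w)/2)) * x\<^sup>2 + of_real (((c-w)/2) * ((c+w)/2))"
      unfolding of_real_add of_real_mult by (simp add: algebra_simps power4_eq_xxxx power2_eq_square)
    then show ?thesis unfolding e by simp
  qed
  then show ?thesis by (rule that)
next
  case False
  then have d: "d > 0" by (smt (verit) zero_le_power2)
  define g where "g = sqrt d"
  have g: "g > 0" "g\<^sup>2 = d" using d by (auto simp: g_def)
  have "c\<^sup>2 < (2*g)\<^sup>2" using False g by (simp add: power_mult_distrib)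
  then have cg: "c < 2*g" using g power2_less_imp_less by (smt (verit))
  define h where "h = sqrt (2*g-c)"
  have h: "h\<^sup>2 = 2*g-c" using cg by (simp add: h_def)
  have e: "2*g - h*h = c" "g*g = d" using g h by (auto simp: power2_eq_square)
  have "x^4 + of_real c * x\<^sup>2 + of_real d
      = (x\<^sup>2 + of_real h * x + of_real g) * (x\<^sup>2 + of_real (-h) * x + of_real g)"
    for x :: 'k
  proof -
    have "(x\<^sup>2 + of_real h * x + of_real g) * (x\<^sup>2 + of_real (-h) * x + of_real g)
      = x^4 + of_real (2*g - h*h) * x\<^sup>2 + of_real (g*g)"
      unfolding of_real_add of_real_mult of_real_diff of_real_minus
      by (simp add: algebra_simps power4_eq_xxxx power2_eq_square)
    then show ?thesis unfolding e by simp
  qed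
  then show ?thesis by (rule that)
qed

text \<open>A monic quadratic in \<open>x\<^sup>2\<close> is a biquadratic in \<open>x\<close>,
  hence a product of two monic quadratics, each of norm at least \<open>m\<^sup>2\<close>.\<close>

lemma quad_bounded_below_square:
  assumes "quad_bounded_below x m"
  shows "quad_bounded_below (x\<^sup>2) (m\<^sup>2)"
  unfolding quad_bounded_below_def
proof (intro allI)
  fix c d
  obtain p q r s where f: "x^4 + of_real c * x\<^sup>2 + of_real d
      = (x\<^sup>2 + of_real p * x + of_real q) * (x\<^sup>2 + of_real r * x + of_real s)"
    using biquadratic_factorization[where ?'k='a] by metis
  have "m\<^sup>2 * m\<^sup>2 \<le> norm (x\<^sup>2 + of_real p * x + of_real q) * norm (x\<^sup>2 + of_real r * x + of_real s)"
    using assms unfolding quad_bounded_below_def by (intro mult_mono) auto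
  then show "(m\<^sup>2)\<^sup>2 \<le> norm ((x\<^sup>2)\<^sup>2 + of_real c * x\<^sup>2 + of_real d)"
    using f by (simp add: norm_mult power2_eq_square power4_eq_xxxx mult.assoc)
qed

lemma quad_bounded_below_iterate:
  assumes "quad_bounded_below x m"
  shows "quad_bounded_below (x^(2^j)) (m^(2^j))"
proof (induction j)
  case (Suc j)
  then show ?case
    using quad_bounded_below_square[OF Suc] by (simp only: power_Suc2 power_mult)
qed (use assms in simp)

text \<open>The inner induction bounds the cofactor of \<open>y - s\<close> in \<open>y^(2^k) - s^(2^k)\<close> from below.\<close>
lemma quad_bounded_below_step:
  assumes y: "quad_bounded_below y m" "norm y = m" and m: "m > 0" and s: "\<bar>s\<bar> < m"
  shows "norm (y - of_real s) = m"
proof -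
  have lower: "norm (y - of_real s) * m^(2^k - 1) \<le> norm (y^(2^k) - of_real s^(2^k))" for k
  proof (induction k)
    case (Suc k)
    have eq: "y^(2^Suc k) - of_real s^(2^Suc k)
        = (y^(2^k) - of_real s^(2^k)) * (y^(2^k) + of_real s^(2^k))"
      by (simp add: algebra_simps power_mult power2_eq_square flip: power_mult_distrib)
    have b: "m^(2^k) \<le> norm (y^(2^k) + of_real s^(2^k))"
      using quad_bounded_below_linear[OF quad_bounded_below_iterate[OF y(1), of k], of "s^(2^k)"] m
      by simp
    have "(2::nat)^Suc k - 1 = (2^k - 1) + 2^k" by simp
    then have "norm (y - of_real s) * m^(2^Suc k - 1)
        = (norm (y - of_real s) * m^(2^k - 1)) * m^(2^k)"
      by (simp only: power_add mult.assoc)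
    also have "\<dots> \<le> norm (y^(2^k) - of_real s^(2^k)) * norm (y^(2^k) + of_real s^(2^k))"
      using Suc b m by (intro mult_mono) auto
    finally show ?case unfolding eq norm_mult .
  qed simp
  \<comment> \<open>As \<open>norm y = m\<close>, the difference of powers is at most
    \<open>m^(2^k)\<close> plus the same power of \<open>abs s\<close>; dividing by the cofactor
    bound leaves an excess over \<open>m\<close> that vanishes because
    \<open>abs s < m\<close>.\<close>
  have ub: "norm (y - of_real s) \<le> m * (1 + (\<bar>s\<bar>/m)^(2^k))" for k
  proof -
    have "norm (y^(2^k) - of_real s^(2^k)) \<le> m^(2^k) + \<bar>s\<bar>^(2^k)"
      using norm_triangle_ineq4[of "y^(2^k)" "of_real s^(2^k)"] y(2) by (simp add: norm_power)
    also have "\<dots> = m^(2^k) * (1 + (\<bar>s\<bar>/m)^(2^k))"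
      using m by (simp add: field_simps)
    also have "m^(2^k) = m^(2^k - 1) * m"
      by (metis One_nat_def Suc_pred zero_less_numeral zero_less_power power_Suc2)
    finally have "norm (y - of_real s) * m^(2^k - 1) \<le> (m * (1 + (\<bar>s\<bar>/m)^(2^k))) * m^(2^k - 1)"
      using lower[of k] by (simp add: mult_ac)
    then show ?thesis using m by (simp add: mult_le_cancel_right)
  qed
  have "(\<lambda>n. (\<bar>s\<bar>/m)^n) \<longlonglongrightarrow> 0"
    using s m by (intro LIMSEQ_power_zero) auto
  then have "(\<lambda>k. (\<bar>s\<bar>/m)^(2^k)) \<longlonglongrightarrow> 0"
    by (rule filterlim_compose[where g="\<lambda>n. (\<bar>s\<bar>/m)^n"])
       (rule filterlim_subseq, simp add: strict_mono_def)
  then have "(\<lambda>k. m * (1 + (\<bar>s\<bar>/m)^(2^k))) \<longlonglongrightarrow> m * (1 + 0)"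
    by (intro tendsto_intros)
  then have "norm (y - of_real s) \<le> m * (1 + 0)"
    by (rule LIMSEQ_le_const) (use ub in auto)
  moreover have "m \<le> norm (y + of_real (-s))"
    by (rule quad_bounded_below_linear[OF y(1)]) (use m in simp)
  ultimately show ?thesis by simp
qed

lemma quad_bounded_below_norm_eq:
  assumes y: "quad_bounded_below y m" "norm y = m"
  shows "m = 0"
proof (rule ccontr)
  assume "m \<noteq> 0"
  then have m: "m > 0" using y(2) by (metis norm_ge_zero order_le_less)
  \<comment> \<open>Steps of length \<open>m/2\<close> stay below the threshold \<open>m\<close>,
    and each translate satisfies the same quadratic bound, so the step can be repeated.\<close>
  have n: "norm (y - of_real (real n * (m/2))) = m" for n
  proof (induction n)
    case (Suc n)
    have "norm ((y + of_real (- (real n * (m/2)))) - of_real (m/2)) = m"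
      by (rule quad_bounded_below_step[OF quad_bounded_below_translate[OF y(1)]])
         (use Suc m in auto)
    moreover have "real (Suc n) * (m/2) = real n * (m/2) + m/2" by (simp add: field_simps)
    ultimately show ?case
      by (simp only: of_real_add of_real_minus diff_conv_add_uminus minus_add_distrib add.assoc)
  qed (use y in simp)
  \<comment> \<open>A shift by \<open>10 * (m/2) = 5 * m\<close> exceeds the \<open>2 * m\<close>
    that the triangle inequality allows; any count above 4 would do.\<close>
  have "norm (of_real (real 10 * (m/2)) :: 'a) \<le> norm y + norm (y - of_real (real 10 * (m/2)))"
    using norm_triangle_ineq4[of y "y - of_real (real 10 * (m/2))"] by simp
  then show False using n[of 10] y(2) m by (simp add: norm_mult)
qed

text \<open>The minimum over \<open>(a, b)\<close> of the norm of
  \<open>(x - a)\<^sup>2 + b\<^sup>2\<close> bounds every monic real quadratic at \<open>x\<close>: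
  one with real roots splits into linear factors, covered by \<open>b = 0\<close>, and any other has
  this form already. Extremality then forces the minimum to be zero.\<close>

lemma real_quadratic_root:
  fixes x :: "'k::real_normed_field"
  obtains a b :: real where "(x - of_real a)\<^sup>2 = - of_real (b\<^sup>2)"
proof -
  define f where "f = (\<lambda>p::real\<times>real. norm ((x - of_real (fst p))\<^sup>2 + of_real ((snd p)\<^sup>2)))"
  \<comment> \<open>For \<open>r > 3 * norm x\<close> the value is at least
    \<open>r\<^sup>2 - 2 * r * norm x - (norm x)\<^sup>2\<close>, which is not below the value
    \<open>(norm x)\<^sup>2\<close> at the origin, so the minimum over the ball is global.\<close>
  define R where "R = 3 * norm x"
  have "compact (cball (0::real\<times>real) R)" "cball (0::real\<times>real) R \<noteq> {}"
    by (auto simp: R_def)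
  moreover have "continuous_on (cball 0 R) f"
    unfolding f_def by (intro continuous_intros)
  ultimately obtain p where p: "p \<in> cball 0 R" "\<And>q. q \<in> cball 0 R \<Longrightarrow> f p \<le> f q"
    using continuous_attains_inf by metis
  have f0: "f 0 = (norm x)\<^sup>2" by (simp add: f_def norm_power)
  have min: "f p \<le> f q" for q
  proof (cases "q \<in> cball 0 R")
    case False
    obtain a b where q: "q = (a,b)" by (cases q)
    define r where "r = norm q"
    have r: "r > 3 * norm x" using False by (simp add: r_def R_def)
    have r2: "r\<^sup>2 = a\<^sup>2 + b\<^sup>2" by (simp add: r_def q norm_Pair)
    have ar: "\<bar>a\<bar> \<le> r" unfolding r_def q by (metis norm_fst_le fst_conv real_norm_def)
    have "of_real (r\<^sup>2) = ((x - of_real a)\<^sup>2 + of_real (b\<^sup>2)) + (of_real (2*a) * x - x\<^sup>2)"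
      unfolding r2 by (simp add: power2_eq_square algebra_simps)
    then have "norm (of_real (r\<^sup>2) :: 'k) \<le> f q + norm (of_real (2*a) * x - x\<^sup>2)"
      unfolding f_def q using norm_triangle_ineq by simp
    also have "norm (of_real (2*a) * x - x\<^sup>2) \<le> norm (of_real (2*a) * x) + norm (x\<^sup>2)"
      by (rule norm_triangle_ineq4)
    also have "\<dots> = 2 * \<bar>a\<bar> * norm x + (norm x)\<^sup>2"
      by (simp add: norm_mult norm_power abs_mult)
    also have "\<dots> \<le> 2 * r * norm x + (norm x)\<^sup>2"
      using ar by (simp add: mult_right_mono)
    finally have "r\<^sup>2 \<le> f q + (2 * r * norm x + (norm x)\<^sup>2)" unfolding norm_of_real by simp
    moreover have "3 * (norm x)\<^sup>2 \<le> r\<^sup>2 - 2 * r * norm x"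
      using mult_mono[of "3 * norm x" r "norm x" "r - 2 * norm x"] r norm_ge_zero[of x]
      by (simp add: power2_eq_square right_diff_distrib mult.assoc mult.left_commute)
    ultimately have "(norm x)\<^sup>2 \<le> f q"
      using zero_le_power2[of "norm x"] by linarith
    moreover have "f p \<le> f 0" by (rule p) (simp add: R_def)
    ultimately show ?thesis using f0 by simp
  qed (rule p)
  define t where "t = x - of_real (fst p)"
  define m where "m = sqrt (f p)"
  have m: "m \<ge> 0" "m\<^sup>2 = f p" by (auto simp: m_def f_def)
  have lin: "m \<le> norm (x - of_real s)" for s
  proof -
    have "m\<^sup>2 \<le> (norm (x - of_real s))\<^sup>2"
      using min[of "(s,0)"] m by (simp add: f_def norm_power)
    then show ?thesis by (rule power2_le_imp_le) simp
  qed
  have "quad_bounded_below x m" unfolding quad_bounded_below_def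
  proof (intro allI)
    fix c d :: real
    show "m\<^sup>2 \<le> norm (x\<^sup>2 + of_real c * x + of_real d)"
    proof (cases "c\<^sup>2/4 - d \<ge> 0")
      case True
      define w where "w = sqrt (c\<^sup>2/4 - d)"
      have w: "w\<^sup>2 = c\<^sup>2/4 - d" using True by (simp add: w_def)
      have "(x - of_real (-c/2-w)) * (x - of_real (-c/2+w)) = x\<^sup>2 + of_real c * x + of_real (c\<^sup>2/4 - w\<^sup>2)"
        by (simp add: power2_eq_square field_simps)
      then have "x\<^sup>2 + of_real c * x + of_real d = (x - of_real (-c/2-w)) * (x - of_real (-c/2+w))"
        unfolding w by simp
      then show ?thesis
        using mult_mono[OF lin[of "-c/2-w"] lin[of "-c/2+w"]] m(1)
        by (simp add: norm_mult power2_eq_square)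
    next
      case False
      define w where "w = sqrt (d - c\<^sup>2/4)"
      have w: "w\<^sup>2 = d - c\<^sup>2/4" using False by (simp add: w_def)
      have "(x - of_real (-c/2))\<^sup>2 + of_real (w\<^sup>2) = x\<^sup>2 + of_real c * x + of_real d"
        unfolding w by (simp add: power2_eq_square field_simps)
      then show ?thesis using min[of "(-c/2,w)"] m by (simp add: f_def)
    qed
  qed
  then have "quad_bounded_below t m"
    using quad_bounded_below_translate[of x m "- fst p"] by (simp add: t_def)
  \<comment> \<open>The minimum is the norm of \<open>t\<^sup>2 + (snd p)\<^sup>2\<close>, and this
    element inherits the quadratic bound with the constant \<open>m\<^sup>2\<close>, which is
    exactly its norm.\<close>
  from quad_bounded_below_translate[OF quad_bounded_below_square[OF this], of "(snd p)\<^sup>2"]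
  have "m\<^sup>2 = 0"
    by (rule quad_bounded_below_norm_eq) (simp add: m t_def f_def)
  then have "(x - of_real (fst p))\<^sup>2 = - of_real ((snd p)\<^sup>2)"
    using m by (simp add: f_def eq_neg_iff_add_eq_0)
  then show ?thesis by (rule that)
qed

text \<open>The quadratic equation of a nonreal element provides \<open>j\<close> with square -1,
  and that of an arbitrary \<open>z\<close> then places it in the span of 1 and \<open>j\<close>. If
  all elements are real, \<open>j = 0\<close> keeps the same form. The coordinate bounds are what
  compactness needs.\<close>

lemma real_normed_field_generator:
  obtains j :: "'k::real_normed_field" where
    "\<And>z. \<exists>a b. z = of_real a + of_real b * j \<and> \<bar>a\<bar> \<le> 2 * norm z \<and> \<bar>b\<bar> \<le> 2 * norm z"
proof (cases "\<forall>z::'k. z \<in> \<real>")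
  case True
  have "\<exists>a b. z = of_real a + of_real b * (0::'k) \<and> \<bar>a\<bar> \<le> 2 * norm z \<and> \<bar>b\<bar> \<le> 2 * norm z" for z :: 'k
  proof -
    obtain a where "z = of_real a" using True Reals_cases by blast
    then show ?thesis by (intro exI[of _ a] exI[of _ 0]) auto
  qed
  then show ?thesis by (rule that)
next
  case False
  then obtain x :: 'k where x: "x \<notin> \<real>" by blast
  obtain a b where ab: "(x - of_real a)\<^sup>2 = - of_real (b\<^sup>2)" by (rule real_quadratic_root)
  have b: "b \<noteq> 0"
  proof
    assume "b = 0"
    then have "x = of_real a" using ab by simp
    then show False using x by simp
  qed
  define j where "j = (x - of_real a) / of_real b"
  have j2: "j\<^sup>2 = -1" using ab b by (simp add: j_def power_divide)
  have jj: "j * j = -1" using j2 by (simp add: power2_eq_square)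
  have nj: "norm j = 1"
    by (metis j2 norm_minus_cancel norm_one norm_power power2_eq_1_iff norm_ge_zero not_one_le_zero neg_0_le_iff_le)
  have "\<exists>a b. z = of_real a + of_real b * j \<and> \<bar>a\<bar> \<le> 2 * norm z \<and> \<bar>b\<bar> \<le> 2 * norm z" for z :: 'k
  proof -
    obtain a b where ab: "(z - of_real a)\<^sup>2 = - of_real (b\<^sup>2)" by (rule real_quadratic_root)
    then have "(z - of_real a)\<^sup>2 = (of_real b * j)\<^sup>2" by (simp add: power_mult_distrib j2)
    then have "z - of_real a = of_real b * j \<or> z - of_real a = - (of_real b * j)"
      by (simp only: power2_eq_iff)
    then obtain c where z: "z = of_real a + of_real c * j"
      by (metis diff_add_cancel add.commute mult_minus_left of_real_minus)
    \<comment> \<open>Multiplying by the conjugate ties the coordinates to \<open>norm z\<close>;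
      this yields the inequality \<open>le\<close>, from which the factor 2 follows.\<close>
    have "z * (of_real a - of_real c * j) = of_real a * of_real a - of_real c * of_real c * (j * j)"
      unfolding z by (simp add: algebra_simps)
    then have "z * (of_real a - of_real c * j) = of_real (a\<^sup>2 + c\<^sup>2)"
      unfolding jj by (simp add: power2_eq_square)
    then have "norm z * norm (of_real a - of_real c * j) = a\<^sup>2 + c\<^sup>2"
      by (metis abs_of_nonneg norm_mult norm_of_real sum_power2_ge_zero)
    moreover have "norm (of_real a - of_real c * j) \<le> \<bar>a\<bar> + \<bar>c\<bar>"
      using norm_triangle_ineq4[of "of_real a" "of_real c * j"] nj by (simp add: norm_mult)
    ultimately have le: "\<bar>a\<bar>\<^sup>2 + \<bar>c\<bar>\<^sup>2 \<le> norm z * (\<bar>a\<bar> + \<bar>c\<bar>)"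
      by (metis mult_left_mono norm_ge_zero power2_abs)
    \<comment> \<open>If \<open>u > 2 * r\<close>, the right-hand side is at most
      \<open>(u\<^sup>2 + u * v) / 2\<close>, and \<open>2 * u * v <= u\<^sup>2 + v\<^sup>2\<close>
      makes this too small.\<close>
    have bd: "u \<le> 2 * r" if "u\<^sup>2 + v\<^sup>2 \<le> r * (u + v)" "u \<ge> 0" "v \<ge> 0" "r \<ge> 0" for u v r :: real
    proof (rule ccontr)
      assume "\<not> u \<le> 2 * r"
      then have u: "2 * r \<le> u" by simp
      have "r * u \<le> u * u / 2" using mult_right_mono[OF u, of u] that by simp
      moreover have "r * v \<le> u * v / 2" using mult_right_mono[OF u, of v] that by simp
      ultimately have "u\<^sup>2 + v\<^sup>2 \<le> u * u / 2 + u * v / 2"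
        using that(1) by (simp add: distrib_left)
      moreover have "2 * (u * v) \<le> u\<^sup>2 + v\<^sup>2" using sum_squares_bound[of u v] by simp
      moreover have "u\<^sup>2 > 0" using \<open>\<not> u \<le> 2 * r\<close> that by auto
      moreover have "v\<^sup>2 \<ge> 0" by simp
      ultimately show False by (simp flip: power2_eq_square)
    qed
    show ?thesis
      using z bd[OF le] bd[of "\<bar>c\<bar>" "\<bar>a\<bar>"] le by (intro exI[of _ a] exI[of _ c]) (auto simp: add.commute)
  qed
  then show ?thesis by (rule that)
qed

lemma compact_cball_real_normed_field: "compact (cball (0::'k::real_normed_field) r)"
proof -
  obtain j :: 'k where j:
    "\<And>z. \<exists>a b. z = of_real a + of_real b * j \<and> \<bar>a\<bar> \<le> 2 * norm z \<and> \<bar>b\<bar> \<le> 2 * norm z"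
    by (rule real_normed_field_generator) blast
  let ?f = "\<lambda>p::real\<times>real. of_real (fst p) + of_real (snd p) * j"
  let ?B = "{-2*r..2*r} \<times> {-2*r..2*r}"
  have "compact (?f ` ?B)"
    by (intro compact_continuous_image compact_Times continuous_intros) auto
  moreover have "cball 0 r \<subseteq> ?f ` ?B"
  proof
    fix z :: 'k assume "z \<in> cball 0 r"
    then have "norm z \<le> r" by simp
    moreover obtain a b where "z = of_real a + of_real b * j" "\<bar>a\<bar> \<le> 2 * norm z" "\<bar>b\<bar> \<le> 2 * norm z"
      using j by blast
    ultimately show "z \<in> ?f ` ?B" by (intro image_eqI[of _ _ "(a,b)"]) auto
  qed
  ultimately have "compact (?f ` ?B \<inter> cball 0 r)" by (intro compact_Int_closed closed_cball)
  then show ?thesis using \<open>cball 0 r \<subseteq> ?f ` ?B\<close> by (simp add: Int_absorb1)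
qed

section \<open>Equicontinuous and precompact sets\<close>

lemma klinear_add: "klinear sm f \<Longrightarrow> f (x + y) = f x + f y"
  and klinear_scale: "klinear sm f \<Longrightarrow> f (sm a x) = a * f x"
  by (auto simp: klinear_def)

locale seminormed =
  fixes sm :: "'k::real_normed_field \<Rightarrow> 'v::ab_group_add \<Rightarrow> 'v" and P :: "nat \<Rightarrow> 'v \<Rightarrow> real"
  assumes module: "module_ax sm" and seminorm: "\<And>n. seminorm_on sm (P n)"
begin

lemma scale_zero: "sm 0 x = 0"
  using module unfolding module_ax_def by (metis add_cancel_right_right add_0)

lemma scale_one: "sm 1 x = x"
  using module unfolding module_ax_def by blast

lemma scale_minus_one: "sm (-1) x = - x"
proof -
  have "sm (-1) x + sm 1 x = sm (-1 + 1) x" using module unfolding module_ax_def by metis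
  then show ?thesis by (simp add: scale_one scale_zero eq_neg_iff_add_eq_0)
qed

lemma seminorm_triangle: "P n (x + y) \<le> P n x + P n y"
  and seminorm_scale: "P n (sm a x) = norm a * P n x"
  using seminorm[of n] by (auto simp: seminorm_on_def)

lemma seminorm_minus: "P n (- x) = P n x"
  using seminorm_scale[of n "-1" x] by (simp add: scale_minus_one)

lemma seminorm_nonneg: "0 \<le> P n x"
proof -
  have "P n 0 = 0" using seminorm_scale[of n 0 0] by (simp add: scale_zero)
  then show ?thesis using seminorm_triangle[of n x "-x"] by (simp add: seminorm_minus)
qed

lemma qsn_nonneg: "0 \<le> qsn P n x"
  by (simp add: qsn_def sum_nonneg seminorm_nonneg)

lemma qsn_scale: "qsn P n (sm a x) = norm a * qsn P n x"
  by (simp add: qsn_def seminorm_scale sum_distrib_left)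

lemma qsn_zero: "qsn P n 0 = 0"
  using qsn_scale[of n 0 0] by (simp add: scale_zero)

lemma qsn_mono: "m \<le> n \<Longrightarrow> qsn P m x \<le> qsn P n x"
  unfolding qsn_def by (intro sum_mono2) (auto simp: seminorm_nonneg)

text \<open>Rescaling \<open>x\<close> to gauge 1 reduces the estimate to the unit ball. Where the
  gauge vanishes, all multiples of \<open>x\<close> lie in the ball, so \<open>f x\<close> must be
  zero.\<close>

lemma klinear_le_qsn:
  assumes f: "klinear sm f" and c: "0 \<le> r" and b: "\<And>x. r * qsn P n x \<le> 1 \<Longrightarrow> norm (f x) \<le> c"
  shows "norm (f x) \<le> c * (r * qsn P n x)"
proof (cases "r * qsn P n x = 0")
  case True
  have le: "t * norm (f x) \<le> c" if "t > 0" for t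
  proof -
    have "r * qsn P n (sm (of_real t) x) \<le> 1"
      using True by (auto simp: qsn_scale)
    from b[OF this] show ?thesis
      using that by (simp add: klinear_scale[OF f] norm_mult)
  qed
  have "norm (f x) = 0"
  proof (rule ccontr)
    assume "norm (f x) \<noteq> 0"
    then show False using le[of "(\<bar>c\<bar> + 1) / norm (f x)"] by simp
  qed
  then show ?thesis unfolding True by simp
next
  case False
  define q where "q = r * qsn P n x"
  have q: "q > 0" using False c qsn_nonneg[of n x] by (simp add: q_def order.order_iff_strict)
  have "r * qsn P n (sm (of_real (1/q)) x) = \<bar>1/q\<bar> * q"
    unfolding qsn_scale norm_of_real q_def by simp
  also have "\<dots> \<le> 1" using q by simp
  finally have "r * qsn P n (sm (of_real (1/q)) x) \<le> 1" .
  from b[OF this] have "norm (f x) / q \<le> c"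
    using q by (simp add: klinear_scale[OF f] norm_mult norm_divide)
  then show ?thesis using q by (simp add: q_def[symmetric] field_simps)
qed

text \<open>One index serves as constant and as seminorm number, so that the dual is an increasing
  union of these sets. Index 0 leaves only the zero functional, the starting point of the selection
  argument.\<close>

definition equicont :: "nat \<Rightarrow> ('v \<Rightarrow> 'k) set" where
  "equicont n = {f. klinear sm f \<and> (\<forall>x. norm (f x) \<le> real n * qsn P n x)}"

lemma equicontD:
  assumes "f \<in> equicont n"
  shows "klinear sm f" "norm (f x) \<le> real n * qsn P n x"
  using assms by (auto simp: equicont_def)

lemma dual_klinear: "f \<in> dual sm P \<Longrightarrow> klinear sm f"
  by (simp add: dual_def)

lemma dualI: "klinear sm f \<Longrightarrow> (\<And>x. norm (f x) \<le> C * qsn P N x) \<Longrightarrow> f \<in> dual sm P"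
  unfolding dual_def by blast

lemma equicont_dual: "f \<in> equicont n \<Longrightarrow> f \<in> dual sm P"
  by (auto simp: equicont_def intro: dualI)

lemma equicont_mono:
  assumes "m \<le> n" shows "equicont m \<subseteq> equicont n"
proof -
  have "real m * qsn P m x \<le> real n * qsn P n x" for x
    using assms by (intro mult_mono qsn_mono qsn_nonneg) auto
  then show ?thesis unfolding equicont_def by (auto intro: order_trans)
qed

lemma dual_equicont:
  assumes "f \<in> dual sm P" obtains n where "f \<in> equicont n"
proof -
  obtain N C where b: "\<And>x. norm (f x) \<le> C * qsn P N x" and f: "klinear sm f"
    using assms unfolding dual_def by blast
  obtain m :: nat where m: "C \<le> real m" using real_arch_simple by blast
  have "C * qsn P N x \<le> real (max m N) * qsn P (max m N) x" for x
  proof -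
    have "C * qsn P N x \<le> real (max m N) * qsn P N x"
      using m by (intro mult_right_mono qsn_nonneg) auto
    also have "\<dots> \<le> real (max m N) * qsn P (max m N) x"
      by (intro mult_left_mono qsn_mono) auto
    finally show ?thesis .
  qed
  then have "f \<in> equicont (max m N)" using f b unfolding equicont_def by (blast intro: order_trans)
  then show ?thesis by (rule that)
qed

lemma dual_equicont2:
  assumes "f \<in> dual sm P" "g \<in> dual sm P" obtains n where "f \<in> equicont n" "g \<in> equicont n"
proof -
  obtain m n where "f \<in> equicont m" "g \<in> equicont n"
    using assms by (metis dual_equicont)
  then have "f \<in> equicont (max m n)" "g \<in> equicont (max m n)"
    using equicont_mono[of m "max m n"] equicont_mono[of n "max m n"] by auto
  then show ?thesis by (rule that)
qed

lemma equicont_add: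
  assumes "f \<in> equicont m" "g \<in> equicont n"
  shows "(\<lambda>x. f x + g x) \<in> equicont (m + n)"
proof -
  have "norm (f x + g x) \<le> real (m + n) * qsn P (m + n) x" for x
  proof -
    have "norm (f x + g x) \<le> norm (f x) + norm (g x)" by (rule norm_triangle_ineq)
    also have "\<dots> \<le> real m * qsn P m x + real n * qsn P n x"
      by (intro add_mono equicontD(2) assms)
    also have "\<dots> \<le> real m * qsn P (m + n) x + real n * qsn P (m + n) x"
      by (intro add_mono mult_left_mono qsn_mono) auto
    finally show ?thesis by (simp add: algebra_simps)
  qed
  moreover have "klinear sm (\<lambda>x. f x + g x)"
    using equicontD(1)[OF assms(1)] equicontD(1)[OF assms(2)]
    by (simp add: klinear_def algebra_simps)
  ultimately show ?thesis by (simp add: equicont_def)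
qed

lemma equicont_zero: "(\<lambda>x. 0) \<in> equicont n"
  by (simp add: equicont_def klinear_def qsn_nonneg)

lemma equicont_scale:
  assumes "f \<in> equicont m" "norm a \<le> real k" "0 < k"
  shows "(\<lambda>x. a * f x) \<in> equicont (k * m)"
proof -
  have "norm (a * f x) \<le> real (k * m) * qsn P (k * m) x" for x
  proof -
    have "norm (a * f x) \<le> real k * (real m * qsn P m x)"
      unfolding norm_mult by (intro mult_mono assms equicontD(2)) auto
    also have "\<dots> \<le> real k * (real m * qsn P (k * m) x)"
      using assms(3) by (intro mult_left_mono qsn_mono) auto
    finally show ?thesis by simp
  qed
  moreover have "klinear sm (\<lambda>x. a * f x)"
    using equicontD(1)[OF assms(1)] by (simp add: klinear_def algebra_simps)
  ultimately show ?thesis by (simp add: equicont_def)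
qed

lemma dual_add: "f \<in> dual sm P \<Longrightarrow> g \<in> dual sm P \<Longrightarrow> (\<lambda>x. f x + g x) \<in> dual sm P"
  by (metis dual_equicont equicont_add equicont_dual)

lemma dual_scale:
  assumes "f \<in> dual sm P" shows "(\<lambda>x. a * f x) \<in> dual sm P"
proof -
  obtain m where "f \<in> equicont m" using assms dual_equicont by blast
  moreover obtain k :: nat where "norm a \<le> real k" using real_arch_simple by blast
  then have "norm a \<le> real (Suc k)" by simp
  ultimately show ?thesis using equicont_scale equicont_dual zero_less_Suc by blast
qed

lemma dual_diff: "f \<in> dual sm P \<Longrightarrow> g \<in> dual sm P \<Longrightarrow> (\<lambda>x. f x - g x) \<in> dual sm P"
  using dual_add[of f "\<lambda>x. (-1) * g x"] dual_scale[of g "-1"] by simp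

text \<open>The injective topology sees only polars; this rescaling carries its estimates to all of
  \<open>equicont n\<close>. Using \<open>Suc n\<close> avoids a division by zero.\<close>

lemma equicont_scale_polar:
  assumes "f \<in> equicont n" shows "(\<lambda>x. of_real (1 / real (Suc n)) * f x) \<in> polar sm P n"
proof -
  have "norm (of_real (1 / real (Suc n)) * f x) \<le> qsn P n x" for x
  proof -
    have "norm (f x) \<le> real (Suc n) * qsn P n x"
      by (rule order_trans[OF equicontD(2)[OF assms]]) (simp add: mult_right_mono qsn_nonneg)
    then show ?thesis unfolding norm_mult norm_of_real by (simp add: field_simps)
  qed
  then show ?thesis
    unfolding polar_def using dual_scale[OF equicont_dual[OF assms]] by blast
qed

lemma zero_polar: "(\<lambda>x. 0) \<in> polar sm P n"
  unfolding polar_def using equicont_zero equicont_dual qsn_nonneg by auto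

text \<open>Alaoglu's theorem for pointwise convergence: Tychonoff's theorem on a product of scalar
  balls, in which linearity is a closed condition.\<close>

lemma compact_equicont: "compact (equicont n)"
proof -
  let ?B = "Pi\<^sub>E UNIV (\<lambda>x. cball (0::'k) (real n * qsn P n x))"
  have "compactin (product_topology (\<lambda>x. euclidean) UNIV) ?B"
    by (simp add: compactin_PiE compact_cball_real_normed_field)
  then have "compact ?B" by (simp add: euclidean_product_topology)
  moreover have "closed {f::'v \<Rightarrow> 'k. klinear sm f}"
    unfolding klinear_def
    by (intro closed_Collect_conj closed_Collect_all closed_Collect_eq continuous_intros) auto
  moreover have "equicont n = ?B \<inter> {f. klinear sm f}"
    by (auto simp: equicont_def PiE_def Pi_def)
  ultimately show ?thesis by (simp add: compact_Int_closed)
qed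

section \<open>Precompact sets\<close>

lemma precompact_empty: "precompact_lcs P {}"
  unfolding precompact_lcs_def by (auto intro: exI[of _ "{}"])

lemma precompact_Un:
  assumes "precompact_lcs P K" "precompact_lcs P L" shows "precompact_lcs P (K \<union> L)"
  unfolding precompact_lcs_def
proof (intro allI impI)
  fix N and e :: real assume "e > 0"
  then obtain F G where "finite F" "K \<subseteq> (\<Union>x\<in>F. {y. qsn P N (y - x) < e})"
    "finite G" "L \<subseteq> (\<Union>x\<in>G. {y. qsn P N (y - x) < e})"
    using assms unfolding precompact_lcs_def by meson
  then show "\<exists>F. finite F \<and> K \<union> L \<subseteq> (\<Union>x\<in>F. {y. qsn P N (y - x) < e})"
    by (intro exI[of _ "F \<union> G"]) auto
qed

lemma precompact_finite:
  assumes "finite K" shows "precompact_lcs P K"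
  unfolding precompact_lcs_def using assms by (auto intro!: exI[of _ K] simp: qsn_zero)

lemma precompact_image:
  assumes T: "cont_lin_op sm P T" and K: "precompact_lcs P K"
  shows "precompact_lcs P (T ` K)"
  unfolding precompact_lcs_def
proof (intro allI impI)
  fix N and e :: real assume e: "e > 0"
  obtain M C where C: "\<And>x. qsn P N (T x) \<le> C * qsn P M x"
    using T unfolding cont_lin_op_def by blast
  have add: "T (x + y) = T x + T y" for x y using T unfolding cont_lin_op_def by blast
  have diff: "T x - T y = T (x - y)" for x y using add[of "x - y" y] by simp
  obtain F where F: "finite F" "K \<subseteq> (\<Union>x\<in>F. {y. qsn P M (y - x) < e / (\<bar>C\<bar> + 1)})"
    using K e unfolding precompact_lcs_def by (meson divide_pos_pos abs_ge_zero add_nonneg_pos zero_less_one)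
  have "qsn P N (T y - T x) < e" if "qsn P M (y - x) < e / (\<bar>C\<bar> + 1)" for x y
  proof -
    have "qsn P N (T y - T x) \<le> C * qsn P M (y - x)" unfolding diff by (rule C)
    also have "\<dots> \<le> (\<bar>C\<bar> + 1) * qsn P M (y - x)" by (intro mult_right_mono qsn_nonneg) auto
    also have "\<dots> < e" using that by (simp add: field_simps)
    finally show ?thesis .
  qed
  then have "T ` K \<subseteq> (\<Union>x\<in>T ` F. {y. qsn P N (y - x) < e})"
    using F(2) by fastforce
  then show "\<exists>F. finite F \<and> T ` K \<subseteq> (\<Union>x\<in>F. {y. qsn P N (y - x) < e})"
    using F(1) by (intro exI[of _ "T ` F"]) auto
qed

text \<open>From some stage on, all vectors lie in a given neighbourhood of 0, so 0 and the finitely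
  many earlier vectors serve as a net.\<close>

lemma precompact_null_sequence:
  assumes fin: "\<And>n. finite (F n)" and small: "\<And>n x. x \<in> F n \<Longrightarrow> real n * qsn P n x \<le> 1"
  shows "precompact_lcs P (\<Union>n. F n)"
  unfolding precompact_lcs_def
proof (intro allI impI)
  fix N and e :: real assume e: "e > 0"
  obtain m :: nat where m: "1 / e < real m" using reals_Archimedean2 by blast
  define k where "k = max m N"
  have k: "qsn P N x < e" if "x \<in> F n" "n \<ge> k" for x n
  proof -
    have n: "1 / e < real n" "N \<le> n" using that(2) m by (auto simp: k_def)
    have "qsn P N x \<le> qsn P n x" by (rule qsn_mono) (rule n)
    also have "\<dots> < e"
    proof (rule ccontr)
      assume "\<not> qsn P n x < e"
      then have "real n * e \<le> real n * qsn P n x" by (intro mult_left_mono) auto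
      moreover have "1 < real n * e" using n e by (simp add: field_simps)
      ultimately show False using small[OF that(1)] by simp
    qed
    finally show ?thesis .
  qed
  have "(\<Union>n. F n) \<subseteq> (\<Union>x\<in>insert 0 (\<Union>n<k. F n). {y. qsn P N (y - x) < e})"
  proof
    fix y assume "y \<in> (\<Union>n. F n)"
    then obtain n where n: "y \<in> F n" by blast
    show "y \<in> (\<Union>x\<in>insert 0 (\<Union>n<k. F n). {y. qsn P N (y - x) < e})"
    proof (cases "n < k")
      case True
      then have "y \<in> insert 0 (\<Union>n<k. F n)" using n by blast
      then show ?thesis using e by (intro UN_I[of y]) (auto simp: qsn_zero)
    next
      case False
      then show ?thesis using k[OF n] by simp
    qed
  qed
  then show "\<exists>F'. finite F' \<and> (\<Union>n. F n) \<subseteq> (\<Union>x\<in>F'. {y. qsn P N (y - x) < e})"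
    using fin by (intro exI[of _ "insert 0 (\<Union>n<k. F n)"]) auto
qed

end

text \<open>The compactness argument in the Banach--Dieudonne theorem: \<open>W n\<close> are the polars of a base of
  neighbourhoods of zero, and the constraints \<open>C j\<close> with \<open>j \<in> V n\<close> cut \<open>W (Suc n)\<close> down to \<open>W n\<close>.\<close>
lemma banach_dieudonne_selection:
  fixes W :: "nat \<Rightarrow> 'a::topological_space set"
  assumes W0: "W 0 \<subseteq> U" and comp: "\<And>n. compact (W n - U)" and C: "\<And>j. closed (C j)"
    and step: "\<And>n. W (Suc n) \<inter> (\<Inter>j\<in>V n. C j) \<subseteq> W n"
  obtains F where "\<And>n. finite (F n)" "\<And>n. F n \<subseteq> V n" "\<And>n. W n \<inter> (\<Inter>j\<in>(\<Union>m<n. F m). C j) \<subseteq> U"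
proof -
  define good where "good = (\<lambda>n G. finite G \<and> W n \<inter> (\<Inter>j\<in>G. C j) \<subseteq> U)"
  have ex: "\<exists>A. finite A \<and> A \<subseteq> V n \<and> good (Suc n) (G \<union> A)" if "good n G" for n G
  proof -
    let ?K = "(W (Suc n) - U) \<inter> (\<Inter>j\<in>G. C j)"
    have "closed (\<Inter>j\<in>G. C j)" by (rule closed_INT) (simp add: C)
    then have K: "compact ?K" by (rule compact_Int_closed[OF comp])
    have empty: "?K \<inter> (\<Inter>j\<in>V n. C j) = {}"
    proof -
      have "?K \<inter> (\<Inter>j\<in>V n. C j) \<subseteq> W n \<inter> (\<Inter>j\<in>G. C j)" using step[of n] by auto
      also have "\<dots> \<subseteq> U" using that by (simp add: good_def)
      finally show ?thesis by auto
    qed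
    \<comment> \<open>Finite intersection property in the compact set of points that still violate
      \<open>U\<close>.\<close>
    have "\<exists>A. finite A \<and> A \<subseteq> V n \<and> ?K \<inter> (\<Inter>j\<in>A. C j) = {}"
    proof (rule ccontr)
      assume "\<not> ?thesis"
      then have "?K \<inter> (\<Inter>j\<in>A. C j) \<noteq> {}" if "finite A" "A \<subseteq> V n" for A
        using that by metis
      then have "?K \<inter> (\<Inter>j\<in>V n. C j) \<noteq> {}"
        by (rule compact_imp_fip_image[OF K C])
      then show False using empty by blast
    qed
    then obtain A where "finite A" "A \<subseteq> V n" "?K \<inter> (\<Inter>j\<in>A. C j) = {}" by blast
    moreover from this(3) have "W (Suc n) \<inter> (\<Inter>j\<in>G \<union> A. C j) \<subseteq> U" by auto
    ultimately show ?thesis using that unfolding good_def by (intro exI[of _ A]) simp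
  qed
  \<comment> \<open>Fixing \<open>G 0 = {}\<close> makes \<open>G n\<close> exactly the union of the
    indices chosen before stage \<open>n\<close>.\<close>
  have "\<exists>G. \<forall>n. (good n (G n) \<and> (n = 0 \<longrightarrow> G n = {}))
      \<and> (\<exists>A. finite A \<and> A \<subseteq> V n \<and> G (Suc n) = G n \<union> A)"
  proof (rule dependent_nat_choice)
    show "\<exists>G. good 0 G \<and> (0 = (0::nat) \<longrightarrow> G = {})" using W0 by (auto simp: good_def)
    show "\<exists>H. (good (Suc n) H \<and> (Suc n = 0 \<longrightarrow> H = {})) \<and> (\<exists>A. finite A \<and> A \<subseteq> V n \<and> H = G \<union> A)"
      if "good n G \<and> (n = 0 \<longrightarrow> G = {})" for G n
      using ex[of n G] that by auto
  qed
  then obtain G where G': "\<forall>n. (good n (G n) \<and> (n = 0 \<longrightarrow> G n = {}))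
      \<and> (\<exists>A. finite A \<and> A \<subseteq> V n \<and> G (Suc n) = G n \<union> A)"
    by (rule exE)
  have G: "good n (G n)" "G 0 = {}" for n using G' by simp_all
  from G' have "\<forall>n. \<exists>A. finite A \<and> A \<subseteq> V n \<and> G (Suc n) = G n \<union> A" by simp
  from choice[OF this] obtain F
    where F: "\<forall>n. finite (F n) \<and> F n \<subseteq> V n \<and> G (Suc n) = G n \<union> F n"
    by (rule exE)
  have "G n = (\<Union>m<n. F m)" for n
    by (induction n) (use F in \<open>simp_all add: G lessThan_Suc Un_commute\<close>)
  then have "W n \<inter> (\<Inter>j\<in>(\<Union>m<n. F m). C j) \<subseteq> U" for n
    using G(1)[of n] by (simp add: good_def)
  then show ?thesis using F by (intro that[of F]) simp_all
qed

section \<open>The group of characters\<close>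

context seminormed
begin

abbreviation tensor_eval :: "('v \<times> 'v) list \<Rightarrow> ('v \<Rightarrow> 'k) \<Rightarrow> ('v \<Rightarrow> 'k) \<Rightarrow> 'k" where
  "tensor_eval t f g \<equiv> (\<Sum>(x, y)\<leftarrow>t. f x * g y)"

lemma tens_eq: "f \<in> dual sm P \<Longrightarrow> g \<in> dual sm P \<Longrightarrow> tens sm P t f g = tensor_eval t f g"
  by (simp add: tens_def)

lemma tensor_eval_scale:
  "tensor_eval t (\<lambda>x. a * f x) (\<lambda>x. b * g x) = a * b * tensor_eval t f g"
  by (induction t) (auto simp: algebra_simps)

lemma tensor_eval_add_left:
  "tensor_eval t (\<lambda>x. f x + f' x) g = tensor_eval t f g + tensor_eval t f' g"
  by (induction t) (auto simp: algebra_simps)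

lemma polar_dual: "f \<in> polar sm P N \<Longrightarrow> f \<in> dual sm P"
  by (simp add: polar_def)

lemma polar_le: "f \<in> polar sm P N \<Longrightarrow> norm (f x) \<le> qsn P N x"
  by (simp add: polar_def)

lemma tens_polar_le:
  assumes "f \<in> polar sm P N" "g \<in> polar sm P N"
  shows "norm (tens sm P t f g) \<le> (\<Sum>(x, y)\<leftarrow>t. qsn P N x * qsn P N y)"
proof -
  have "norm (tensor_eval t f g) \<le> (\<Sum>(x, y)\<leftarrow>t. qsn P N x * qsn P N y)"
  proof (induction t)
    case (Cons p t)
    obtain x y where p: "p = (x, y)" by (cases p)
    have "norm (f x * g y) \<le> qsn P N x * qsn P N y"
      unfolding norm_mult by (intro mult_mono polar_le assms qsn_nonneg) auto
    then show ?case using Cons p by (auto intro: order_trans[OF norm_triangle_ineq])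
  qed simp
  then show ?thesis by (simp add: tens_eq polar_dual[OF assms(1)] polar_dual[OF assms(2)])
qed

lemma tens_ctens: "tens sm P t \<in> ctens sm P"
  unfolding ctens_def eps_approx_def by (auto simp: tens_def intro!: exI[of _ "\<lambda>_. t"])

text \<open>A real supremum is informative only for a bounded set; a finite tensor uniformly within
  1 of \<open>B\<close> supplies the bound.\<close>

lemma eps_norm_upper:
  assumes B: "B \<in> ctens sm P" and f: "f \<in> polar sm P N" and g: "g \<in> polar sm P N"
  shows "norm (B f g) \<le> eps_norm sm P N B"
proof -
  obtain ts where "eps_approx sm P ts B" using B unfolding ctens_def by blast
  then obtain K where K: "\<And>f g. f \<in> polar sm P N \<Longrightarrow> g \<in> polar sm P N \<Longrightarrow>
      norm (B f g - tens sm P (ts K) f g) \<le> 1"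
    unfolding eps_approx_def by (meson order_refl zero_less_one)
  let ?c = "1 + (\<Sum>(x, y)\<leftarrow>ts K. qsn P N x * qsn P N y)"
  have "norm (B f g) \<le> ?c" if "f \<in> polar sm P N" "g \<in> polar sm P N" for f g
    using K[OF that] tens_polar_le[OF that, of "ts K"] norm_triangle_sub[of "B f g" "tens sm P (ts K) f g"]
    by linarith
  then have "bdd_above {norm (B f g) |f g. f \<in> polar sm P N \<and> g \<in> polar sm P N}"
    by (intro bdd_aboveI[of _ ?c]) blast
  then show ?thesis unfolding eps_norm_def using f g by (intro cSup_upper) blast
qed

lemma eps_norm_nonneg: "B \<in> ctens sm P \<Longrightarrow> 0 \<le> eps_norm sm P N B"
  using eps_norm_upper[OF _ zero_polar zero_polar] norm_ge_zero order_trans by blast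

lemma eps_norm_tens_le: "eps_norm sm P N (tens sm P [(x, y)]) \<le> qsn P N x * qsn P N y"
  unfolding eps_norm_def
proof (rule cSup_least)
  show "{norm (tens sm P [(x, y)] f g) |f g. f \<in> polar sm P N \<and> g \<in> polar sm P N} \<noteq> {}"
    using zero_polar by blast
  show "z \<le> qsn P N x * qsn P N y"
    if "z \<in> {norm (tens sm P [(x, y)] f g) |f g. f \<in> polar sm P N \<and> g \<in> polar sm P N}" for z
    using that tens_polar_le[where t = "[(x, y)]"] by auto
qed

text \<open>\<open>eps_approx\<close> only controls polars, and \<open>B\<close> is not assumed bilinear, so the limit has to be
  expressed through rescaled functionals.\<close>
lemma ext_eval_tendsto:
  assumes ts: "eps_approx sm P ts B" and f: "f \<in> dual sm P" and g: "g \<in> dual sm P"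
  shows "(\<lambda>k. tensor_eval (ts k) f g) \<longlonglongrightarrow> ext_eval sm P (\<lambda>x y. f x * g y) B"
proof -
  obtain n where n: "f \<in> equicont n" "g \<in> equicont n" using dual_equicont2[OF f g] .
  define c :: 'k where "c = of_real (1 / real (Suc n))"
  have c: "c \<noteq> 0" by (simp add: c_def del: of_nat_Suc)
  let ?f = "\<lambda>x. c * f x" and ?g = "\<lambda>x. c * g x"
  have pol: "?f \<in> polar sm P n" "?g \<in> polar sm P n"
    unfolding c_def by (intro equicont_scale_polar n)+
  \<comment> \<open>The candidate is computed from \<open>B\<close> alone, so it is the same for
    every approximating sequence; this is the uniqueness behind \<open>ext_eval\<close>.\<close>
  define w where "w = B ?f ?g / (c * c)"
  have lim: "(\<lambda>k. tensor_eval (us k) f g) \<longlonglongrightarrow> w" if "eps_approx sm P us B" for us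
  proof -
    have "(\<lambda>k. tens sm P (us k) ?f ?g) \<longlonglongrightarrow> B ?f ?g"
    proof (rule LIMSEQ_I)
      fix r :: real assume "r > 0"
      then have "r / 2 > 0" by simp
      with that have "\<exists>K. \<forall>k\<ge>K. \<forall>f\<in>polar sm P n. \<forall>g\<in>polar sm P n.
          norm (B f g - tens sm P (us k) f g) \<le> r / 2"
        unfolding eps_approx_def by blast
      then obtain K where "\<And>k. k \<ge> K \<Longrightarrow> norm (B ?f ?g - tens sm P (us k) ?f ?g) \<le> r / 2"
        using pol by blast
      then show "\<exists>K. \<forall>k\<ge>K. norm (tens sm P (us k) ?f ?g - B ?f ?g) < r"
        using \<open>r > 0\<close> by (intro exI[of _ K]) (force simp: norm_minus_commute)
    qed
    then have "(\<lambda>k. c * c * tensor_eval (us k) f g) \<longlonglongrightarrow> B ?f ?g"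
      by (simp add: tens_eq polar_dual[OF pol(1)] polar_dual[OF pol(2)] tensor_eval_scale)
    then have "(\<lambda>k. (c * c * tensor_eval (us k) f g) / (c * c)) \<longlonglongrightarrow> w"
      unfolding w_def by (intro tendsto_divide tendsto_const) (use c in auto)
    then show ?thesis using c by simp
  qed
  have "ext_eval sm P (\<lambda>x y. f x * g y) B = w"
    unfolding ext_eval_def
    by (rule the_equality) (use ts lim LIMSEQ_unique in blast)+
  then show ?thesis using lim[OF ts] by simp
qed

end

section \<open>Bilinear calculus for the comultiplication\<close>

locale eps_hopf =
  fixes sm :: "'k::real_normed_field \<Rightarrow> 'v::ab_group_add \<Rightarrow> 'v" and P :: "nat \<Rightarrow> 'v \<Rightarrow> real"
    and mu :: "'v \<Rightarrow> 'v \<Rightarrow> 'v" and one :: 'v and Delta :: "'v \<Rightarrow> ('k, 'v) bform"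
    and counit :: "'v \<Rightarrow> 'k" and S :: "'v \<Rightarrow> 'v"
  assumes hopf: "eps_hopf_frechet sm P mu one Delta counit S"

sublocale eps_hopf \<subseteq> seminormed sm P
proof -
  have "frechet sm P" using hopf unfolding eps_hopf_frechet_def by (rule conjunct1)
  then show "seminormed sm P" unfolding frechet_def by unfold_locales simp_all
qed

context eps_hopf
begin

lemma mu_add_left [rule_format]: "\<forall>x y z. mu (x + y) z = mu x z + mu y z"
  and mu_add_right [rule_format]: "\<forall>x y z. mu x (y + z) = mu x y + mu x z"
  and mu_scale_left [rule_format]: "\<forall>a x y. mu (sm a x) y = sm a (mu x y)"
  and mu_scale_right [rule_format]: "\<forall>a x y. mu x (sm a y) = sm a (mu x y)"
  and mu_bound: "\<forall>M. \<exists>N C. \<forall>t. qsn P M (\<Sum>(x, y)\<leftarrow>t. mu x y) \<le> C * eps_norm sm P N (tens sm P t)"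
  and mu_one [rule_format]: "\<forall>x. mu one x = x \<and> mu x one = x"
  by (insert hopf[unfolded eps_hopf_frechet_def], (elim conjE, assumption)+)

lemma Delta_ctens [rule_format]: "\<forall>x. Delta x \<in> ctens sm P"
  and Delta_add [rule_format]: "\<forall>x y f g. Delta (x + y) f g = Delta x f g + Delta y f g"
  and Delta_scale [rule_format]: "\<forall>a x f g. Delta (sm a x) f g = a * Delta x f g"
  and Delta_bound: "\<forall>N. \<exists>M C. \<forall>x. eps_norm sm P N (Delta x) \<le> C * qsn P M x"
  and coassoc [rule_format]: "\<forall>x. \<forall>f\<in>dual sm P. \<forall>g\<in>dual sm P. \<forall>h\<in>dual sm P.
    Delta x (\<lambda>y. Delta y f g) h = Delta x f (\<lambda>y. Delta y g h)"
  and counit_dual: "counit \<in> dual sm P"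
  and counit_neutral [rule_format]:
    "\<forall>x. \<forall>h\<in>dual sm P. Delta x counit h = h x \<and> Delta x h counit = h x"
  by (insert hopf[unfolded eps_hopf_frechet_def], (elim conjE, assumption)+)

lemma counit_one: "counit one = 1"
  and counit_mu [rule_format]: "\<forall>x y. counit (mu x y) = counit x * counit y"
  and Delta_one [rule_format]:
    "\<forall>f\<in>dual sm P. \<forall>g\<in>dual sm P. Delta one f g = f one * g one"
  and Delta_mu [rule_format]: "\<forall>x y. \<forall>f\<in>dual sm P. \<forall>g\<in>dual sm P.
    Delta (mu x y) f g = ext_eval sm P (\<lambda>a b. Delta y (\<lambda>c. f (mu a c)) (\<lambda>d. g (mu b d))) (Delta x)"
  and antipode_cont: "cont_lin_op sm P S"
  and antipode [rule_format]: "\<forall>x. \<forall>h\<in>dual sm P.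
    ext_eval sm P (\<lambda>a b. h (mu (S a) b)) (Delta x) = counit x * h one
    \<and> ext_eval sm P (\<lambda>a b. h (mu a (S b))) (Delta x) = counit x * h one"
  by (insert hopf[unfolded eps_hopf_frechet_def], (elim conjE, assumption)+)

lemma mu_continuous:
  obtains N C where "0 \<le> C" "\<And>x y. qsn P M (mu x y) \<le> C * (qsn P N x * qsn P N y)"
proof -
  obtain N C where C: "\<And>t. qsn P M (\<Sum>(x, y)\<leftarrow>t. mu x y) \<le> C * eps_norm sm P N (tens sm P t)"
    using mu_bound by blast
  have "qsn P M (mu x y) \<le> \<bar>C\<bar> * (qsn P N x * qsn P N y)" for x y
  proof -
    have "qsn P M (mu x y) \<le> C * eps_norm sm P N (tens sm P [(x, y)])"
      using C[of "[(x, y)]"] by simp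
    also have "\<dots> \<le> \<bar>C\<bar> * eps_norm sm P N (tens sm P [(x, y)])"
      by (intro mult_right_mono eps_norm_nonneg tens_ctens) auto
    also have "\<dots> \<le> \<bar>C\<bar> * (qsn P N x * qsn P N y)"
      by (intro mult_left_mono eps_norm_tens_le) auto
    finally show ?thesis .
  qed
  then show ?thesis by (rule that[rotated]) auto
qed

lemma dual_mu_bound:
  assumes "f \<in> dual sm P"
  obtains N C where "0 \<le> C" "\<And>x y. norm (f (mu x y)) \<le> C * (qsn P N x * qsn P N y)"
proof -
  obtain n where n: "f \<in> equicont n" using assms by (rule dual_equicont)
  obtain N C where C: "0 \<le> C" "\<And>x y. qsn P n (mu x y) \<le> C * (qsn P N x * qsn P N y)"
    using mu_continuous[of n] by metis
  have "norm (f (mu x y)) \<le> (real n * C) * (qsn P N x * qsn P N y)" for x y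
    using order_trans[OF equicontD(2)[OF n] mult_left_mono[OF C(2)]] by (simp add: mult.assoc)
  then show ?thesis using C(1) by (intro that[of "real n * C" N]) auto
qed

lemma dual_mu_left:
  assumes f: "f \<in> dual sm P" shows "(\<lambda>y. f (mu a y)) \<in> dual sm P"
proof -
  obtain N C where C: "\<And>x y. norm (f (mu x y)) \<le> C * (qsn P N x * qsn P N y)"
    using dual_mu_bound[OF f] by metis
  have "norm (f (mu a y)) \<le> (C * qsn P N a) * qsn P N y" for y
    using C[of a y] by (simp add: mult.assoc)
  moreover have "klinear sm (\<lambda>y. f (mu a y))"
    using dual_klinear[OF f] by (simp add: klinear_def mu_add_right mu_scale_right)
  ultimately show ?thesis using dualI by blast
qed

text \<open>The bialgebra axiom with second factor the unit determines \<open>Delta x f g\<close> also for functionals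
  outside the polars, where membership in \<open>ctens\<close> says nothing.\<close>
lemma Delta_eq_ext_eval:
  assumes "f \<in> dual sm P" "g \<in> dual sm P"
  shows "Delta x f g = ext_eval sm P (\<lambda>a b. f a * g b) (Delta x)"
  using Delta_mu[OF assms, of x one]
  by (simp add: mu_one Delta_one dual_mu_left assms)

lemma Delta_tendsto:
  assumes "eps_approx sm P ts (Delta x)" "f \<in> dual sm P" "g \<in> dual sm P"
  shows "(\<lambda>k. tensor_eval (ts k) f g) \<longlonglongrightarrow> Delta x f g"
  using ext_eval_tendsto[OF assms] by (simp add: Delta_eq_ext_eval assms)

lemma Delta_approx:
  obtains ts where "eps_approx sm P ts (Delta x)"
  using Delta_ctens unfolding ctens_def by blast

text \<open>Finite tensors are bilinear, and \<open>Delta_tendsto\<close> passes this to the limit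
  for arbitrary continuous functionals.\<close>

lemma Delta_scale_args:
  assumes f: "f \<in> dual sm P" and g: "g \<in> dual sm P"
  shows "Delta x (\<lambda>y. a * f y) (\<lambda>y. b * g y) = a * b * Delta x f g"
proof -
  obtain ts where ts: "eps_approx sm P ts (Delta x)" by (rule Delta_approx)
  have "(\<lambda>k. a * b * tensor_eval (ts k) f g) \<longlonglongrightarrow> a * b * Delta x f g"
    by (intro tendsto_intros Delta_tendsto ts f g)
  moreover have "(\<lambda>k. a * b * tensor_eval (ts k) f g) \<longlonglongrightarrow> Delta x (\<lambda>y. a * f y) (\<lambda>y. b * g y)"
    using Delta_tendsto[OF ts dual_scale[OF f, of a] dual_scale[OF g, of b]]
    by (simp only: tensor_eval_scale)
  ultimately show ?thesis using LIMSEQ_unique by blast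
qed

lemma Delta_scale_left:
  "f \<in> dual sm P \<Longrightarrow> g \<in> dual sm P \<Longrightarrow> Delta x (\<lambda>y. a * f y) g = a * Delta x f g"
  using Delta_scale_args[of f g x a 1] by simp

lemma Delta_scale_right:
  "f \<in> dual sm P \<Longrightarrow> g \<in> dual sm P \<Longrightarrow> Delta x f (\<lambda>y. a * g y) = a * Delta x f g"
  using Delta_scale_args[of f g x 1 a] by simp

lemma Delta_add_left:
  assumes f: "f \<in> dual sm P" and f': "f' \<in> dual sm P" and g: "g \<in> dual sm P"
  shows "Delta x (\<lambda>y. f y + f' y) g = Delta x f g + Delta x f' g"
proof -
  obtain ts where ts: "eps_approx sm P ts (Delta x)" by (rule Delta_approx)
  have "(\<lambda>k. tensor_eval (ts k) f g + tensor_eval (ts k) f' g) \<longlonglongrightarrow> Delta x f g + Delta x f' g"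
    by (intro tendsto_add Delta_tendsto ts f f' g)
  moreover have "(\<lambda>k. tensor_eval (ts k) f g + tensor_eval (ts k) f' g) \<longlonglongrightarrow> Delta x (\<lambda>y. f y + f' y) g"
    using Delta_tendsto[OF ts dual_add[OF f f'] g] by (simp only: tensor_eval_add_left)
  ultimately show ?thesis using LIMSEQ_unique by blast
qed

text \<open>Rescaling both arguments into the polar multiplies the error by \<open>r * r\<close>, so
  the estimate is requested there with tolerance \<open>e * (r * r)\<close>.\<close>

lemma Delta_approx_uniform:
  assumes ts: "eps_approx sm P ts (Delta x)" and e: "e > 0"
  obtains K where "\<And>k f g. k \<ge> K \<Longrightarrow> f \<in> equicont n \<Longrightarrow> g \<in> equicont n \<Longrightarrow>
    norm (Delta x f g - tensor_eval (ts k) f g) \<le> e"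
proof -
  define r where "r = 1 / real (Suc n)"
  have r: "r > 0" by (simp add: r_def)
  then have "e * (r * r) > 0" using e by simp
  then obtain K where K: "\<And>k f g. k \<ge> K \<Longrightarrow> f \<in> polar sm P n \<Longrightarrow> g \<in> polar sm P n \<Longrightarrow>
    norm (Delta x f g - tens sm P (ts k) f g) \<le> e * (r * r)"
    using ts unfolding eps_approx_def by meson
  have "norm (Delta x f g - tensor_eval (ts k) f g) \<le> e"
    if k: "k \<ge> K" and f: "f \<in> equicont n" and g: "g \<in> equicont n" for k f g
  proof -
    let ?f = "\<lambda>x. of_real r * f x" and ?g = "\<lambda>x. of_real r * g x"
    have pol: "?f \<in> polar sm P n" "?g \<in> polar sm P n"
      unfolding r_def by (intro equicont_scale_polar f g)+
    have "Delta x ?f ?g - tens sm P (ts k) ?f ?g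
        = of_real (r * r) * (Delta x f g - tensor_eval (ts k) f g)"
      by (simp add: tens_eq polar_dual[OF pol(1)] polar_dual[OF pol(2)] tensor_eval_scale
          Delta_scale_args equicont_dual[OF f] equicont_dual[OF g] right_diff_distrib)
    then have "(r * r) * norm (Delta x f g - tensor_eval (ts k) f g) \<le> e * (r * r)"
      using K[OF k pol] by (simp add: norm_mult del: of_real_mult)
    then show ?thesis using r by simp
  qed
  then show ?thesis by (rule that)
qed

text \<open>Separate constants \<open>c\<close> and \<open>d\<close> keep the bound homogeneous in
  each argument, which later gives continuity in a parameter on which one functional depends. A zero
  constant cannot be divided out, but it forces a zero functional.\<close>

lemma Delta_le:
  obtains M K where "0 \<le> K" "\<And>x f g c d. f \<in> dual sm P \<Longrightarrow> g \<in> dual sm P \<Longrightarrow> 0 \<le> c \<Longrightarrow> 0 \<le> d \<Longrightarrow>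
    (\<And>y. norm (f y) \<le> c * qsn P N y) \<Longrightarrow> (\<And>y. norm (g y) \<le> d * qsn P N y) \<Longrightarrow>
    norm (Delta x f g) \<le> c * d * (K * qsn P M x)"
proof -
  obtain M K where MK: "\<And>x. eps_norm sm P N (Delta x) \<le> K * qsn P M x"
    using Delta_bound by blast
  have "norm (Delta x f g) \<le> c * d * (\<bar>K\<bar> * qsn P M x)"
    if f: "f \<in> dual sm P" and g: "g \<in> dual sm P" and c: "0 \<le> c" and d: "0 \<le> d"
      and fc: "\<And>y. norm (f y) \<le> c * qsn P N y" and gd: "\<And>y. norm (g y) \<le> d * qsn P N y"
    for x f g c d
  proof -
    consider "c = 0" | "d = 0" | "c > 0" "d > 0" using c d by linarith
    then show ?thesis
    proof cases
      case 1
      then have "f = (\<lambda>y. 0 * f y)" using fc by auto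
      then have "Delta x f g = 0" using Delta_scale_left[OF f g, of x 0] by simp
      then show ?thesis using 1 by simp
    next
      case 2
      then have "g = (\<lambda>y. 0 * g y)" using gd by auto
      then have "Delta x f g = 0" using Delta_scale_right[OF f g, of x 0] by simp
      then show ?thesis using 2 by simp
    next
      case 3
      let ?f = "\<lambda>y. of_real (1/c) * f y" and ?g = "\<lambda>y. of_real (1/d) * g y"
      have fn: "norm (?f y) \<le> qsn P N y" for y
        unfolding norm_mult norm_of_real using fc[of y] 3 by (simp add: field_simps)
      have gn: "norm (?g y) \<le> qsn P N y" for y
        unfolding norm_mult norm_of_real using gd[of y] 3 by (simp add: field_simps)
      have pol: "?f \<in> polar sm P N" "?g \<in> polar sm P N"
        unfolding polar_def using fn gn dual_scale[OF f] dual_scale[OF g] by blast+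
      have "(1/c) * (1/d) * norm (Delta x f g) = norm (Delta x ?f ?g)"
        unfolding Delta_scale_args[OF f g] norm_mult norm_of_real using 3 by simp
      also have "\<dots> \<le> eps_norm sm P N (Delta x)"
        by (rule eps_norm_upper[OF Delta_ctens pol])
      also have "\<dots> \<le> K * qsn P M x" by (rule MK)
      also have "\<dots> \<le> \<bar>K\<bar> * qsn P M x" by (intro mult_right_mono qsn_nonneg) auto
      finally show ?thesis using 3 by (simp add: field_simps)
    qed
  qed
  then show ?thesis by (rule that[rotated]) auto
qed

lemma conv_dual:
  assumes f: "f \<in> dual sm P" and g: "g \<in> dual sm P"
  shows "conv Delta f g \<in> dual sm P"
proof -
  obtain n where n: "f \<in> equicont n" "g \<in> equicont n" using dual_equicont2[OF f g] .
  obtain M K where "\<And>x f g c d. f \<in> dual sm P \<Longrightarrow> g \<in> dual sm P \<Longrightarrow> 0 \<le> c \<Longrightarrow> 0 \<le> d \<Longrightarrow>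
    (\<And>y. norm (f y) \<le> c * qsn P n y) \<Longrightarrow> (\<And>y. norm (g y) \<le> d * qsn P n y) \<Longrightarrow>
    norm (Delta x f g) \<le> c * d * (K * qsn P M x)"
    using Delta_le[of n] by metis
  from this[OF f g of_nat_0_le_iff of_nat_0_le_iff equicontD(2)[OF n(1)] equicontD(2)[OF n(2)]]
  have "norm (conv Delta f g x) \<le> (real n * real n * K) * qsn P M x" for x
    by (simp add: conv_def mult.assoc)
  moreover have "klinear sm (conv Delta f g)"
    by (simp add: klinear_def conv_def Delta_add Delta_scale)
  ultimately show ?thesis using dualI by blast
qed

lemma conv_assoc:
  "f \<in> dual sm P \<Longrightarrow> g \<in> dual sm P \<Longrightarrow> h \<in> dual sm P \<Longrightarrow>
    conv Delta (conv Delta f g) h = conv Delta f (conv Delta g h)"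
  unfolding conv_def using coassoc by blast

lemma conv_counit:
  "h \<in> dual sm P \<Longrightarrow> conv Delta counit h = h"
  "h \<in> dual sm P \<Longrightarrow> conv Delta h counit = h"
  unfolding conv_def using counit_neutral by blast+

lemma conv_scale_left:
  "f \<in> dual sm P \<Longrightarrow> g \<in> dual sm P \<Longrightarrow> conv Delta (\<lambda>y. a * f y) g = (\<lambda>x. a * conv Delta f g x)"
  unfolding conv_def using Delta_scale_left by blast

section \<open>Characters under convolution and antipode\<close>

lemma characterD:
  assumes "w \<in> characters sm P mu one"
  shows "w \<in> dual sm P" "w one = 1" "w (mu x y) = w x * w y"
  using assms by (auto simp: characters_def)

lemma counit_character: "counit \<in> characters sm P mu one"
  by (simp add: characters_def counit_dual counit_one counit_mu)

text \<open>With \<open>f\<close> and \<open>g\<close> multiplicative, the inner comultiplication in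
  the bialgebra axiom becomes \<open>f a * g b\<close> times the scalar \<open>Delta y f g\<close>,
  which can be pulled out.\<close>

lemma conv_character:
  assumes f: "f \<in> characters sm P mu one" and g: "g \<in> characters sm P mu one"
  shows "conv Delta f g \<in> characters sm P mu one"
proof -
  note f' = characterD[OF f] and g' = characterD[OF g]
  have "Delta (mu x y) f g = Delta x f g * Delta y f g" for x y
  proof -
    have "Delta (mu x y) f g = ext_eval sm P (\<lambda>a b. (Delta y f g * f a) * g b) (Delta x)"
      unfolding Delta_mu[OF f'(1) g'(1)] by (simp add: f' g' Delta_scale_args mult_ac)
    also have "\<dots> = Delta x (\<lambda>a. Delta y f g * f a) g"
      by (simp add: Delta_eq_ext_eval dual_scale f' g')
    finally show ?thesis by (simp add: Delta_scale_left f' g')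
  qed
  then show ?thesis
    using conv_dual[OF f'(1) g'(1)] by (simp add: characters_def conv_def Delta_one f' g')
qed

lemma antipode_dual:
  assumes f: "f \<in> dual sm P" shows "f \<circ> S \<in> dual sm P"
proof -
  obtain n where n: "f \<in> equicont n" using f by (rule dual_equicont)
  obtain N C where C: "\<And>x. qsn P n (S x) \<le> C * qsn P N x"
    using antipode_cont unfolding cont_lin_op_def by blast
  have "norm ((f \<circ> S) x) \<le> (real n * C) * qsn P N x" for x
    using order_trans[OF equicontD(2)[OF n] mult_left_mono[OF C]] by (simp add: mult.assoc)
  moreover have "klinear sm (f \<circ> S)"
    using equicontD(1)[OF n] antipode_cont by (simp add: klinear_def cont_lin_op_def)
  ultimately show ?thesis using dualI by blast
qed

lemma conv_antipode:
  assumes w: "w \<in> characters sm P mu one"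
  shows "conv Delta (w \<circ> S) w = counit" "conv Delta w (w \<circ> S) = counit"
proof -
  note w' = characterD[OF w]
  have "Delta x (w \<circ> S) w = counit x" "Delta x w (w \<circ> S) = counit x" for x
    using antipode[OF w'(1), of x]
    by (simp_all add: Delta_eq_ext_eval antipode_dual w')
  then show "conv Delta (w \<circ> S) w = counit" "conv Delta w (w \<circ> S) = counit"
    unfolding conv_def by blast+
qed

text \<open>Instead of showing that the antipode is anti-multiplicative, which would require elements of
  the completed tensor product of H with itself as arguments, both sides are convolved with \<open>w\<close>
  and the right inverse of \<open>w\<close> is cancelled, one variable at a time.\<close>
lemma antipode_character:
  assumes w: "w \<in> characters sm P mu one"
  shows "w \<circ> S \<in> characters sm P mu one"
proof -
  note w' = characterD[OF w]
  define r where "r = w \<circ> S"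
  have r: "r \<in> dual sm P" unfolding r_def by (rule antipode_dual) (rule w')
  have rw: "conv Delta r w = counit" "conv Delta w r = counit"
    unfolding r_def by (rule conv_antipode[OF w])+
  \<comment> \<open>Right convolution by \<open>w\<close> is injective because \<open>r\<close> is a
    right inverse of \<open>w\<close>.\<close>
  have cancel: "f = (\<lambda>x. a * r x)" if f: "f \<in> dual sm P" and fw: "conv Delta f w = (\<lambda>x. a * counit x)" for f a
  proof -
    have "f = conv Delta f (conv Delta w r)" by (simp add: rw conv_counit f)
    also have "\<dots> = conv Delta (\<lambda>x. a * counit x) r"
      using conv_assoc[OF f w'(1) r] fw by simp
    also have "\<dots> = (\<lambda>x. a * r x)"
      by (simp add: conv_scale_left counit_dual r conv_counit)
    finally show ?thesis .
  qed
  have ra: "(\<lambda>y. r (mu a y)) \<in> dual sm P" for a by (rule dual_mu_left[OF r])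
  have L: "Delta y (\<lambda>c. r (mu a c)) w = counit y * r a" for y a
  proof -
    let ?L = "\<lambda>a. Delta y (\<lambda>c. r (mu a c)) w"
    \<comment> \<open>Cancellation applies to continuous functionals only, so the dependence on
      \<open>a\<close> must be shown linear and bounded; the bound comes from the factor
      \<open>qsn P N a\<close> in \<open>rm\<close>.\<close>
    have dual: "?L \<in> dual sm P"
    proof -
      obtain N C where C: "0 \<le> C" "\<And>x y. norm (r (mu x y)) \<le> C * (qsn P N x * qsn P N y)"
        using dual_mu_bound[OF r] by metis
      obtain n where n: "w \<in> equicont n" using w'(1) by (rule dual_equicont)
      define m where "m = max n N"
      have wm: "norm (w y) \<le> real m * qsn P m y" for y
        using n equicont_mono[of n m] by (auto simp: m_def equicont_def)
      have rm: "norm (r (mu a c)) \<le> (C * qsn P N a) * qsn P m c" for a c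
      proof -
        have "norm (r (mu a c)) \<le> (C * qsn P N a) * qsn P N c" using C(2)[of a c] by (simp add: mult.assoc)
        also have "\<dots> \<le> (C * qsn P N a) * qsn P m c"
          using C(1) by (intro mult_left_mono qsn_mono mult_nonneg_nonneg qsn_nonneg) (auto simp: m_def)
        finally show ?thesis .
      qed
      obtain M K where K: "\<And>x f g c d. f \<in> dual sm P \<Longrightarrow> g \<in> dual sm P \<Longrightarrow> 0 \<le> c \<Longrightarrow> 0 \<le> d \<Longrightarrow>
        (\<And>y. norm (f y) \<le> c * qsn P m y) \<Longrightarrow> (\<And>y. norm (g y) \<le> d * qsn P m y) \<Longrightarrow>
        norm (Delta x f g) \<le> c * d * (K * qsn P M x)"
        using Delta_le[of m] by metis
      have "norm (?L a) \<le> (C * (real m * (K * qsn P M y))) * qsn P N a" for a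
        using K[OF ra w'(1) mult_nonneg_nonneg[OF C(1) qsn_nonneg] of_nat_0_le_iff rm wm, of y a]
        by (simp add: mult_ac)
      moreover have "?L (a + b) = ?L a + ?L b" for a b
      proof -
        have "r (mu (a + b) c) = r (mu a c) + r (mu b c)" for c
          by (simp add: mu_add_left klinear_add[OF dual_klinear[OF r]])
        then show ?thesis by (simp add: Delta_add_left ra w')
      qed
      moreover have "?L (sm t a) = t * ?L a" for a t
      proof -
        have "r (mu (sm t a) c) = t * r (mu a c)" for c
          by (simp add: mu_scale_left klinear_scale[OF dual_klinear[OF r]])
        then show ?thesis by (simp add: Delta_scale_left ra w')
      qed
      ultimately show ?thesis by (intro dualI[of ?L]) (auto simp: klinear_def)
    qed
    \<comment> \<open>The identity \<open>conv Delta r w = counit\<close> is evaluated at a product: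
      the character \<open>w\<close> splits, and what remains is \<open>?L\<close> convolved with
      \<open>w\<close>.\<close>
    have "Delta x ?L w = counit y * counit x" for x
    proof -
      have "counit (mu x y) = Delta (mu x y) r w"
        using rw(1) unfolding conv_def by metis
      also have "\<dots> = ext_eval sm P (\<lambda>a b. ?L a * w b) (Delta x)"
        unfolding Delta_mu[OF r w'(1)] by (simp add: w' Delta_scale_right ra mult.commute)
      also have "\<dots> = Delta x ?L w"
        by (simp add: Delta_eq_ext_eval dual w')
      finally show ?thesis by (simp add: counit_mu mult.commute)
    qed
    then have "conv Delta ?L w = (\<lambda>x. counit y * counit x)" unfolding conv_def by blast
    from fun_cong[OF cancel[OF dual this]] show ?thesis .
  qed
  \<comment> \<open>The second cancellation, now for the functional \<open>r (mu a -)\<close>, with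
    \<open>L\<close> as its hypothesis.\<close>
  have "r (mu a y) = r a * r y" for a y
  proof -
    have "conv Delta (\<lambda>c. r (mu a c)) w = (\<lambda>x. r a * counit x)"
      unfolding conv_def by (simp add: L mult.commute)
    from fun_cong[OF cancel[OF ra this]] show ?thesis .
  qed
  moreover have "r one = 1"
    using fun_cong[OF rw(1), of one] by (simp add: conv_def Delta_one r w' counit_one)
  ultimately show ?thesis using r unfolding r_def characters_def by blast
qed

end

section \<open>Uniform convergence on precompact sets\<close>

context seminormed
begin

abbreviation ucp :: "('v \<Rightarrow> 'k) topology" where
  "ucp \<equiv> ucp_topology P"

lemma openin_ucp:
  "openin ucp U \<longleftrightarrow> (\<forall>f\<in>U. \<exists>K e. precompact_lcs P K \<and> e > 0
      \<and> {g. \<forall>x\<in>K. norm (g x - f x) < e} \<subseteq> U)"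
proof -
  let ?op = "\<lambda>U::('v \<Rightarrow> 'k) set. \<forall>f\<in>U. \<exists>K e. precompact_lcs P K \<and> e > 0
      \<and> {g. \<forall>x\<in>K. norm (g x - f x) < e} \<subseteq> U"
  have "?op (U \<inter> V)" if U: "?op U" and V: "?op V" for U V
  proof
    fix f assume f: "f \<in> U \<inter> V"
    obtain K d where K: "precompact_lcs P K" "d > 0" "{g. \<forall>x\<in>K. norm (g x - f x) < d} \<subseteq> U"
      using U f by blast
    obtain L e where L: "precompact_lcs P L" "e > 0" "{g. \<forall>x\<in>L. norm (g x - f x) < e} \<subseteq> V"
      using V f by blast
    have "{g. \<forall>x\<in>K \<union> L. norm (g x - f x) < min d e} \<subseteq> U \<inter> V" using K L by auto
    then show "\<exists>K e. precompact_lcs P K \<and> e > 0 \<and> {g. \<forall>x\<in>K. norm (g x - f x) < e} \<subseteq> U \<inter> V"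
      using K L precompact_Un by (intro exI[of _ "K \<union> L"] exI[of _ "min d e"]) auto
  qed
  moreover have "?op (\<Union>\<U>)" if "\<forall>U\<in>\<U>. ?op U" for \<U>
  proof
    fix f assume "f \<in> \<Union>\<U>"
    then obtain U where U: "U \<in> \<U>" "f \<in> U" by blast
    from bspec[OF bspec[OF that U(1)] U(2)]
    obtain K e where "precompact_lcs P K" "e > 0" "{g. \<forall>x\<in>K. norm (g x - f x) < e} \<subseteq> U"
      by (elim exE conjE)
    then show "\<exists>K e. precompact_lcs P K \<and> e > 0 \<and> {g. \<forall>x\<in>K. norm (g x - f x) < e} \<subseteq> \<Union>\<U>"
      using U by (intro exI[of _ K] exI[of _ e]) auto
  qed
  ultimately have "istopology ?op" unfolding istopology_def by blast
  then show ?thesis unfolding ucp_topology_def by simp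
qed

lemma topspace_ucp: "topspace ucp = UNIV"
proof -
  have "openin ucp UNIV" unfolding openin_ucp
    using precompact_empty by (auto intro: exI[of _ "{}"] exI[of _ "1::real"])
  then show ?thesis using openin_subset by blast
qed

text \<open>The strict ball \<open>{g. \<forall>x\<in>K. norm (g x - f x) < e}\<close> itself need not be open.\<close>
lemma ucp_open_ball:
  assumes K: "precompact_lcs P K" and e: "e > 0"
  obtains U where "openin ucp U" "f \<in> U" "\<And>g x. g \<in> U \<Longrightarrow> x \<in> K \<Longrightarrow> norm (g x - f x) < e"
proof -
  let ?U = "{g. \<exists>d<e. \<forall>x\<in>K. norm (g x - f x) \<le> d}"
  have "openin ucp ?U" unfolding openin_ucp
  proof
    fix g assume "g \<in> ?U"
    then obtain d where d: "d < e" "\<forall>x\<in>K. norm (g x - f x) \<le> d" by blast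
    have "h \<in> ?U" if "\<forall>x\<in>K. norm (h x - g x) < (e - d) / 2" for h
    proof -
      have "norm (h x - f x) \<le> (e + d) / 2" if "x \<in> K" for x
      proof -
        have "norm (h x - f x) \<le> norm (h x - g x) + norm (g x - f x)"
          using norm_triangle_ineq[of "h x - g x" "g x - f x"] by simp
        also have "\<dots> \<le> (e - d) / 2 + d"
          using d \<open>x \<in> K\<close> \<open>\<forall>x\<in>K. norm (h x - g x) < (e - d) / 2\<close> by (intro add_mono) auto
        finally show ?thesis by (simp add: field_simps)
      qed
      moreover have "(e + d) / 2 < e" using d by simp
      ultimately show ?thesis by blast
    qed
    then show "\<exists>K d. precompact_lcs P K \<and> d > 0 \<and> {h. \<forall>x\<in>K. norm (h x - g x) < d} \<subseteq> ?U"
      using K d by (intro exI[of _ K] exI[of _ "(e - d) / 2"]) auto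
  qed
  moreover have "f \<in> ?U" using e by (auto intro!: exI[of _ 0])
  ultimately show ?thesis by (rule that) (auto intro: le_less_trans)
qed

text \<open>Every open neighbourhood of \<open>h a\<close> contains a uniform ball on a precompact
  set, so uniform closeness there is enough.\<close>

lemma continuous_map_into_ucp:
  assumes A: "\<And>a. a \<in> topspace X \<Longrightarrow> h a \<in> A"
    and near: "\<And>a K e. a \<in> topspace X \<Longrightarrow> precompact_lcs P K \<Longrightarrow> e > 0 \<Longrightarrow>
      \<exists>W. openin X W \<and> a \<in> W \<and> (\<forall>b\<in>W. \<forall>x\<in>K. norm (h b x - h a x) < e)"
  shows "continuous_map X (subtopology ucp A) h"
proof -
  have "openin X {a \<in> topspace X. h a \<in> U}" if U: "openin ucp U" for U
  proof (subst openin_subopen, intro ballI)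
    fix a assume a: "a \<in> {a \<in> topspace X. h a \<in> U}"
    then have aX: "a \<in> topspace X" and "h a \<in> U" by simp_all
    from bspec[OF U[unfolded openin_ucp] this(2)]
    obtain K e where K: "precompact_lcs P K" "e > 0" "{g. \<forall>x\<in>K. norm (g x - h a x) < e} \<subseteq> U"
      by (elim exE conjE)
    from near[OF aX K(1,2)]
    obtain W where W: "openin X W" "a \<in> W" "\<forall>b\<in>W. \<forall>x\<in>K. norm (h b x - h a x) < e"
      by (elim exE conjE)
    have "W \<subseteq> {a \<in> topspace X. h a \<in> U}"
    proof
      fix b assume "b \<in> W"
      then have "b \<in> topspace X" "h b \<in> {g. \<forall>x\<in>K. norm (g x - h a x) < e}"
        using W(3) openin_subset[OF W(1)] by auto
      then show "b \<in> {a \<in> topspace X. h a \<in> U}" using K(3) by blast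
    qed
    then show "\<exists>W. openin X W \<and> a \<in> W \<and> W \<subseteq> {a \<in> topspace X. h a \<in> U}" using W by blast
  qed
  then have "continuous_map X ucp h" unfolding continuous_map_def by (simp add: topspace_ucp)
  then show ?thesis using A by (auto simp: continuous_map_in_subtopology)
qed

text \<open>The values eventually lie in a compact ball and so have a cluster point; the Cauchy
  property on the precompact set \<open>{x}\<close> promotes it to a limit.\<close>

lemma ucp_cauchy_pointwise_limit:
  fixes F :: "('v \<Rightarrow> 'k) filter"
  assumes F: "F \<noteq> bot" and cauchy: "ucp_cauchy P F"
  shows "\<exists>l. ((\<lambda>f. f x) \<longlongrightarrow> l) F"
proof -
  have "\<exists>A. eventually (\<lambda>f. f \<in> A) F \<and> (\<forall>f\<in>A. \<forall>g\<in>A. norm (f x - g x) < e)" if "e > 0" for e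
    using cauchy precompact_finite[of "{x}"] that unfolding ucp_cauchy_def by force
  note small = this
  obtain A where A: "eventually (\<lambda>f. f \<in> A) F" "\<And>f g. f \<in> A \<Longrightarrow> g \<in> A \<Longrightarrow> norm (f x - g x) < 1"
    using small[of 1] by auto
  obtain f0 where f0: "f0 \<in> A" using A(1) F eventually_happens by blast
  let ?B = "cball (0::'k) (norm (f0 x) + 1)"
  have "f x \<in> ?B" if "f \<in> A" for f
    using A(2)[OF that f0] norm_triangle_sub[of "f x" "f0 x"] by simp
  then have "eventually (\<lambda>z. z \<in> ?B) (filtermap (\<lambda>f. f x) F)"
    unfolding eventually_filtermap using A(1) by (auto elim: eventually_mono)
  moreover have "filtermap (\<lambda>f. f x) F \<noteq> bot" using F by (simp add: filtermap_bot_iff)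
  ultimately obtain l where l: "inf (nhds l) (filtermap (\<lambda>f. f x) F) \<noteq> bot"
    using compact_cball_real_normed_field[where ?'k='k] unfolding compact_filter le_principal by blast
  have "((\<lambda>f. f x) \<longlongrightarrow> l) F"
  proof (rule tendstoI)
    fix e :: real assume "e > 0"
    then have e: "e / 2 > 0" by simp
    then obtain A where A: "eventually (\<lambda>f. f \<in> A) F" "\<And>f g. f \<in> A \<Longrightarrow> g \<in> A \<Longrightarrow> norm (f x - g x) < e / 2"
      using small[OF e] by blast
    have "eventually (\<lambda>z. z \<in> (\<lambda>f. f x) ` A) (filtermap (\<lambda>f. f x) F)"
      unfolding eventually_filtermap using A(1) by (auto elim: eventually_mono)
    moreover have "eventually (\<lambda>z. dist z l < e / 2) (nhds l)"
      using e eventually_nhds_metric by blast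
    ultimately have "eventually (\<lambda>z. dist z l < e / 2 \<and> z \<in> (\<lambda>f. f x) ` A)
        (inf (nhds l) (filtermap (\<lambda>f. f x) F))"
      unfolding eventually_inf by blast
    then obtain g where g: "g \<in> A" "dist (g x) l < e / 2"
      using eventually_happens'[OF l] by blast
    have "dist (f x) l < e" if "f \<in> A" for f
      using dist_triangle[of "f x" l "g x"] A(2)[OF that g(1)] g(2) by (simp add: dist_norm)
    then show "eventually (\<lambda>f. dist (f x) l < e) F" using A(1) by (auto elim: eventually_mono)
  qed
  then show ?thesis by blast
qed

lemma ucp_cauchy_converges:
  fixes F :: "('v \<Rightarrow> 'k) filter"
  assumes F: "F \<noteq> bot" and cauchy: "ucp_cauchy P F" and w: "\<And>x. ((\<lambda>f. f x) \<longlongrightarrow> w x) F"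
  shows "ucp_converges P F w"
  unfolding ucp_converges_def
proof (intro allI impI, elim conjE)
  fix K and e :: real assume K: "precompact_lcs P K" and "e > 0"
  then have "e / 2 > 0" by simp
  then obtain A where A: "eventually (\<lambda>f. f \<in> A) F" "\<And>f g x. f \<in> A \<Longrightarrow> g \<in> A \<Longrightarrow> x \<in> K \<Longrightarrow> norm (f x - g x) < e / 2"
    using cauchy K unfolding ucp_cauchy_def by meson
  have "norm (f x - w x) < e" if "f \<in> A" "x \<in> K" for f x
  proof -
    \<comment> \<open>With \<open>f\<close> fixed in the small set \<open>A\<close>, letting
      \<open>g\<close> run to the limit preserves the non-strict bound \<open>e / 2\<close>.\<close>
    have "((\<lambda>g. norm (f x - g x)) \<longlongrightarrow> norm (f x - w x)) F"
      by (intro tendsto_intros w)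
    moreover have "eventually (\<lambda>g. norm (f x - g x) \<le> e / 2) F"
      using A(1) by (rule eventually_mono) (use A(2)[OF that(1) _ that(2)] in \<open>auto intro: less_imp_le\<close>)
    ultimately have "norm (f x - w x) \<le> e / 2"
      using tendsto_upperbound F by blast
    then show ?thesis using \<open>e > 0\<close> by simp
  qed
  then show "eventually (\<lambda>f. \<forall>x\<in>K. norm (f x - w x) < e) F"
    using A(1) by (auto elim: eventually_mono)
qed

text \<open>An unbounded limit would be large along a null sequence, which is a precompact set.\<close>
lemma ucp_limit_dual:
  assumes F: "F \<noteq> bot" and dual: "eventually (\<lambda>f. f \<in> dual sm P) F"
    and conv: "ucp_converges P F w" and lin: "klinear sm w"
  shows "w \<in> dual sm P"
proof (rule ccontr)
  assume not: "w \<notin> dual sm P"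
  \<comment> \<open>The threshold 2 leaves room for the contradiction: a nearby continuous
    \<open>f\<close> is at most 1 on one of these vectors and differs from \<open>w\<close> there by
    less than 1.\<close>
  have "\<exists>x. real n * qsn P n x \<le> 1 \<and> norm (w x) > 2" for n
  proof (rule ccontr)
    assume "\<not> ?thesis"
    then have "norm (w x) \<le> 2 * (real n * qsn P n x)" for x
      by (intro klinear_le_qsn[OF lin]) (auto simp: not_less)
    then have "w \<in> dual sm P" by (intro dualI[OF lin, of "2 * real n"]) (simp add: mult.assoc)
    then show False using not by blast
  qed
  then obtain X where X: "\<And>n. real n * qsn P n (X n) \<le> 1" "\<And>n. norm (w (X n)) > 2" by metis
  have "precompact_lcs P (\<Union>n. {X n})" by (rule precompact_null_sequence) (auto simp: X)
  then have "eventually (\<lambda>f. \<forall>x\<in>(\<Union>n. {X n}). norm (f x - w x) < 1) F"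
    using conv unfolding ucp_converges_def by (meson zero_less_one)
  then have "eventually (\<lambda>f. f \<in> dual sm P \<and> (\<forall>x\<in>(\<Union>n. {X n}). norm (f x - w x) < 1)) F"
    by (intro eventually_conj dual)
  from eventually_happens'[OF F this]
  obtain f where f: "f \<in> dual sm P" "\<And>n. norm (f (X n) - w (X n)) < 1" by auto
  obtain m where "f \<in> equicont m" using f(1) by (rule dual_equicont)
  then have "norm (f (X m)) \<le> 1" by (rule order_trans[OF equicontD(2) X(1)])
  then show False
    using X(2)[of m] f(2)[of m] norm_triangle_sub[of "w (X m)" "f (X m)"] by (simp add: norm_minus_commute)
qed

end

section \<open>Joint continuity of convolution\<close>

context eps_hopf
begin

lemma Delta_diff: "Delta (x - y) f g = Delta x f g - Delta y f g"
  using Delta_add[of "x - y" y f g] by simp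

lemma tensor_eval_continuous:
  "continuous_on A (\<lambda>p. tensor_eval t (\<lambda>y. f y + fst p y) (\<lambda>y. g y + snd p y))"
proof (induction t)
  case (Cons z t)
  obtain x y where z: "z = (x, y)" by (cases z)
  have c: "continuous_on A (\<lambda>p. fst p x)" "continuous_on A (\<lambda>p. snd p y)"
    by (rule continuous_on_product_then_coordinatewise[OF continuous_on_fst[OF continuous_on_id]]
        continuous_on_product_then_coordinatewise[OF continuous_on_snd[OF continuous_on_id]])+
  show ?case unfolding z using Cons c by (auto intro!: continuous_intros)
qed simp

text \<open>A uniform limit of continuous functions: the translated arguments stay in
  \<open>equicont (m + n)\<close>, where finite tensors approximate \<open>Delta x\<close>
  uniformly.\<close>

lemma Delta_continuous_on_equicont:
  assumes f: "f \<in> equicont m" and g: "g \<in> equicont m"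
  shows "continuous_on (equicont n \<times> equicont n) (\<lambda>p. Delta x (\<lambda>y. f y + fst p y) (\<lambda>y. g y + snd p y))"
proof -
  obtain ts where ts: "eps_approx sm P ts (Delta x)" by (rule Delta_approx)
  have "uniform_limit (equicont n \<times> equicont n)
      (\<lambda>k p. tensor_eval (ts k) (\<lambda>y. f y + fst p y) (\<lambda>y. g y + snd p y))
      (\<lambda>p. Delta x (\<lambda>y. f y + fst p y) (\<lambda>y. g y + snd p y)) sequentially"
  proof (rule uniform_limitI)
    fix e :: real assume e: "e > 0"
    then obtain K where K: "\<And>k f g. k \<ge> K \<Longrightarrow> f \<in> equicont (m + n) \<Longrightarrow> g \<in> equicont (m + n) \<Longrightarrow>
        norm (Delta x f g - tensor_eval (ts k) f g) \<le> e / 2"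
      using Delta_approx_uniform[OF ts half_gt_zero[OF e], of "m + n"] by metis
    show "\<forall>\<^sub>F k in sequentially. \<forall>p\<in>equicont n \<times> equicont n.
        dist (tensor_eval (ts k) (\<lambda>y. f y + fst p y) (\<lambda>y. g y + snd p y))
          (Delta x (\<lambda>y. f y + fst p y) (\<lambda>y. g y + snd p y)) < e"
    proof (rule eventually_sequentiallyI[of K], intro ballI)
      fix k p assume k: "K \<le> k" and p: "p \<in> equicont n \<times> equicont n"
      have "norm (Delta x (\<lambda>y. f y + fst p y) (\<lambda>y. g y + snd p y)
          - tensor_eval (ts k) (\<lambda>y. f y + fst p y) (\<lambda>y. g y + snd p y)) \<le> e / 2"
        using p by (intro K k equicont_add f g) auto
      then show "dist (tensor_eval (ts k) (\<lambda>y. f y + fst p y) (\<lambda>y. g y + snd p y))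
          (Delta x (\<lambda>y. f y + fst p y) (\<lambda>y. g y + snd p y)) < e"
        unfolding dist_norm using e by (subst norm_minus_commute) linarith
    qed
  qed
  then show ?thesis
    by (rule uniform_limit_theorem[rotated]) (simp, intro always_eventually allI, rule tensor_eval_continuous)
qed

text \<open>One set \<open>K\<close> must serve all continuous \<open>f'\<close> and
  \<open>g'\<close>. It collects the finite sets of the selection, applied to pairs of differences
  from \<open>(f, g)\<close>; radius 1 appears because the selection works with polars.\<close>

lemma conv_ucp_near:
  assumes f: "f \<in> dual sm P" and g: "g \<in> dual sm P" and L: "precompact_lcs P L" and e: "e > 0"
  obtains K where "precompact_lcs P K"
    "\<And>f' g' x. f' \<in> dual sm P \<Longrightarrow> g' \<in> dual sm P \<Longrightarrow> \<forall>x\<in>K. norm (f' x - f x) < 1 \<Longrightarrow>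
      \<forall>x\<in>K. norm (g' x - g x) < 1 \<Longrightarrow> x \<in> L \<Longrightarrow> norm (conv Delta f' g' x - conv Delta f g x) < e"
proof -
  obtain m where m: "f \<in> equicont m" "g \<in> equicont m" using dual_equicont2[OF f g] .
  define Z where "Z = (\<lambda>x p. Delta x (\<lambda>y. f y + fst p y) (\<lambda>y. g y + snd p y))"
  \<comment> \<open>The margin \<open>d < e\<close> makes \<open>U\<close> relatively open in every
    \<open>W n\<close>, although the condition ranges over all of \<open>L\<close>.\<close>
  define U where "U = {p. \<exists>d<e. \<forall>x\<in>L. norm (Z x p - Delta x f g) \<le> d}"
  define W where "W = (\<lambda>n. equicont n \<times> equicont n)"
  define C where "C = (\<lambda>x. {p::('v \<Rightarrow> 'k) \<times> ('v \<Rightarrow> 'k). norm (fst p x) \<le> 1 \<and> norm (snd p x) \<le> 1})"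
  define V where "V = (\<lambda>n. {x. real n * qsn P n x \<le> 1})"
  have Zcont: "continuous_on (W n) (Z x)" for n x
    unfolding W_def Z_def by (rule Delta_continuous_on_equicont[OF m])
  \<comment> \<open>A Lipschitz estimate in \<open>x\<close>, uniform over \<open>W n\<close>,
    reduces the precompact set \<open>L\<close> to a finite net.\<close>
  have Zdiff: "\<exists>M B. 0 \<le> B \<and> (\<forall>p\<in>W n. \<forall>x y. norm (Z x p - Z y p) \<le> B * qsn P M (x - y))" for n
  proof -
    obtain M K where K: "0 \<le> K" "\<And>x f g c d. f \<in> dual sm P \<Longrightarrow> g \<in> dual sm P \<Longrightarrow> 0 \<le> c \<Longrightarrow> 0 \<le> d \<Longrightarrow>
      (\<And>y. norm (f y) \<le> c * qsn P (m + n) y) \<Longrightarrow> (\<And>y. norm (g y) \<le> d * qsn P (m + n) y) \<Longrightarrow>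
      norm (Delta x f g) \<le> c * d * (K * qsn P M x)"
      using Delta_le[of "m + n"] by metis
    have "norm (Z x p - Z y p) \<le> (real (m + n) * real (m + n) * K) * qsn P M (x - y)" if "p \<in> W n" for p x y
    proof -
      have q: "(\<lambda>y. f y + fst p y) \<in> equicont (m + n)" "(\<lambda>y. g y + snd p y) \<in> equicont (m + n)"
        using that m equicont_add unfolding W_def by auto
      show ?thesis
        using K(2)[OF equicont_dual[OF q(1)] equicont_dual[OF q(2)] of_nat_0_le_iff of_nat_0_le_iff
            equicontD(2)[OF q(1)] equicontD(2)[OF q(2)], of "x - y"]
        by (simp add: Z_def Delta_diff mult.assoc)
    qed
    then show ?thesis using K(1)
      by (intro exI[of _ M] exI[of _ "real (m + n) * real (m + n) * K"]) auto
  qed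
  have Uopen: "\<exists>G. open G \<and> p \<in> G \<and> G \<inter> W n \<subseteq> U" if p: "p \<in> W n" "p \<in> U" for p n
  proof -
    obtain d where d: "d < e" "\<And>x. x \<in> L \<Longrightarrow> norm (Z x p - Delta x f g) \<le> d"
      using p(2) unfolding U_def by blast
    \<comment> \<open>Three errors of size \<open>r\<close> are added below: two from moving to a
      net point, one from moving \<open>p\<close>. A quarter of the margin leaves strict
      room.\<close>
    define r where "r = (e - d) / 4"
    have r: "r > 0" using d by (simp add: r_def)
    obtain M B where B: "0 \<le> B" "\<And>p x y. p \<in> W n \<Longrightarrow> norm (Z x p - Z y p) \<le> B * qsn P M (x - y)"
      using Zdiff[of n] by blast
    have "r / (B + 1) > 0" using r B by simp
    then obtain F where F: "finite F" "L \<subseteq> (\<Union>x\<in>F. {y. qsn P M (y - x) < r / (B + 1)})"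
      using L unfolding precompact_lcs_def by meson
    have close: "norm (Z y q - Z x q) \<le> r" if "q \<in> W n" "qsn P M (y - x) < r / (B + 1)" for q x y
    proof -
      have "norm (Z y q - Z x q) \<le> B * qsn P M (y - x)" by (rule B) (rule that)
      also have "\<dots> \<le> (B + 1) * qsn P M (y - x)" by (intro mult_right_mono qsn_nonneg) simp
      also have "\<dots> \<le> r" using that(2) B(1) by (simp add: field_simps)
      finally show ?thesis .
    qed
    have "\<forall>\<^sub>F q in at p within W n. \<forall>x\<in>F. dist (Z x q) (Z x p) < r"
    proof (rule eventually_ball_finite[OF F(1)], rule ballI)
      fix x
      show "\<forall>\<^sub>F q in at p within W n. dist (Z x q) (Z x p) < r"
        using Zcont[of n x] p(1) r unfolding continuous_on_def by (blast intro: tendstoD)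
    qed
    then obtain G where G: "open G" "p \<in> G"
      "\<And>q x. q \<in> G \<Longrightarrow> q \<noteq> p \<Longrightarrow> q \<in> W n \<Longrightarrow> x \<in> F \<Longrightarrow> dist (Z x q) (Z x p) < r"
      unfolding eventually_at_topological by blast
    have "q \<in> U" if q: "q \<in> G" "q \<in> W n" for q
    proof -
      have "norm (Z y q - Delta y f g) \<le> d + 3 * r" if y: "y \<in> L" for y
      proof -
        obtain x where x: "x \<in> F" "qsn P M (y - x) < r / (B + 1)" using F(2) y by blast
        have "norm (Z y q - Z x q) \<le> r" "norm (Z y p - Z x p) \<le> r" by (intro close x q p)+
        moreover have "norm (Z x q - Z x p) \<le> r"
          using G(3)[OF q(1) _ q(2) x(1)] r by (cases "q = p") (auto simp: dist_norm intro: less_imp_le)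
        moreover have "norm (Z y p - Delta y f g) \<le> d" by (rule d(2)) (rule y)
        moreover have "norm (Z y q - Delta y f g) \<le> norm (Z y q - Z x q) + norm (Z x q - Z x p)
            + norm (Z y p - Z x p) + norm (Z y p - Delta y f g)"
        proof -
          have "Z y q - Delta y f g = ((Z y q - Z x q) + (Z x q - Z x p)) - (Z y p - Z x p) + (Z y p - Delta y f g)"
            by simp
          then show ?thesis
            by (smt (verit) norm_triangle_ineq norm_triangle_ineq4)
        qed
        ultimately show ?thesis by simp
      qed
      moreover have "d + 3 * r < e" using d by (simp add: r_def field_simps)
      ultimately show ?thesis unfolding U_def by blast
    qed
    then show ?thesis using G by blast
  qed
  \<comment> \<open>Openness of \<open>U\<close> is known only relative to each \<open>W n\<close>,
    so \<open>U\<close> is replaced by the union of all open sets whose trace on \<open>W n\<close>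
    lies in \<open>U\<close>.\<close>
  have comp: "compact (W n - U)" for n
  proof -
    let ?G = "\<Union>{G. open G \<and> G \<inter> W n \<subseteq> U}"
    have "W n - U = W n \<inter> - ?G"
    proof (intro equalityI subsetI)
      fix p assume "p \<in> W n - U"
      then show "p \<in> W n \<inter> - ?G" by auto
    next
      fix p assume p: "p \<in> W n \<inter> - ?G"
      have "p \<notin> U"
      proof
        assume "p \<in> U"
        from Uopen[OF IntD1[OF p] this] obtain G where "open G" "p \<in> G" "G \<inter> W n \<subseteq> U"
          by (elim exE conjE)
        then show False using p by auto
      qed
      then show "p \<in> W n - U" using p by simp
    qed
    moreover have "closed (- ?G)" by (intro closed_Compl open_Union) blast
    moreover have "compact (W n)" unfolding W_def by (intro compact_Times compact_equicont)
    ultimately show ?thesis by (simp add: compact_Int_closed)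
  qed
  have W0: "W 0 \<subseteq> U"
  proof
    fix p assume "p \<in> W 0"
    then have "fst p = (\<lambda>_. 0)" "snd p = (\<lambda>_. 0)"
      unfolding W_def equicont_def by auto
    then show "p \<in> U" using e unfolding U_def Z_def by (auto intro!: exI[of _ 0])
  qed
  have Cclosed: "closed (C x)" for x
  proof -
    have "continuous_on UNIV (\<lambda>p::('v \<Rightarrow> 'k) \<times> ('v \<Rightarrow> 'k). fst p x)"
      "continuous_on UNIV (\<lambda>p::('v \<Rightarrow> 'k) \<times> ('v \<Rightarrow> 'k). snd p x)"
      by (rule continuous_on_product_then_coordinatewise[OF continuous_on_fst[OF continuous_on_id]]
        continuous_on_product_then_coordinatewise[OF continuous_on_snd[OF continuous_on_id]])+
    then show ?thesis unfolding C_def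
      by (intro closed_Collect_conj closed_Collect_le continuous_on_norm continuous_on_const)
  qed
  \<comment> \<open>By homogeneity, a linear functional bounded by 1 on \<open>V n\<close> satisfies
    the estimate of \<open>equicont n\<close>; linearity comes from membership in
    \<open>W (Suc n)\<close>.\<close>
  have step: "W (Suc n) \<inter> (\<Inter>x\<in>V n. C x) \<subseteq> W n" for n
  proof
    fix p assume p: "p \<in> W (Suc n) \<inter> (\<Inter>x\<in>V n. C x)"
    have "h \<in> equicont n" if "h = fst p \<or> h = snd p" for h
    proof -
      have lin: "klinear sm h" using p that equicontD(1) by (auto simp: W_def)
      have "norm (h x) \<le> 1 * (real n * qsn P n x)" for x
        by (rule klinear_le_qsn[OF lin]) (use p that in \<open>auto simp: V_def C_def\<close>)
      then show ?thesis using lin by (simp add: equicont_def)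
    qed
    then show "p \<in> W n" by (cases p) (auto simp: W_def)
  qed
  obtain F where F: "\<And>n. finite (F n)" "\<And>n. F n \<subseteq> V n" "\<And>n. W n \<inter> (\<Inter>x\<in>(\<Union>m<n. F m). C x) \<subseteq> U"
    using banach_dieudonne_selection[of W U C V, OF W0 comp Cclosed step] by metis
  let ?K = "\<Union>n. F n"
  have "precompact_lcs P ?K"
    by (rule precompact_null_sequence[OF F(1)]) (use F(2) in \<open>auto simp: V_def\<close>)
  moreover have "norm (conv Delta f' g' x - conv Delta f g x) < e"
    if f': "f' \<in> dual sm P" and g': "g' \<in> dual sm P"
      and fK: "\<forall>x\<in>?K. norm (f' x - f x) < 1" and gK: "\<forall>x\<in>?K. norm (g' x - g x) < 1" and x: "x \<in> L"
    for f' g' x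
  proof -
    define p where "p = (\<lambda>x. f' x - f x, \<lambda>x. g' x - g x)"
    \<comment> \<open>The index \<open>n\<close> depends on \<open>f'\<close> and \<open>g'\<close>,
      but \<open>?K\<close> contains the test vectors of all stages.\<close>
    obtain n where "(\<lambda>x. f' x - f x) \<in> equicont n" "(\<lambda>x. g' x - g x) \<in> equicont n"
      using dual_equicont2[OF dual_diff[OF f' f] dual_diff[OF g' g]] .
    then have "p \<in> W n" by (simp add: p_def W_def)
    moreover have "p \<in> (\<Inter>x\<in>(\<Union>m<n. F m). C x)"
      using fK gK by (auto simp: p_def C_def intro: less_imp_le)
    ultimately have "p \<in> U" using F(3) by blast
    then show ?thesis using x by (auto simp: U_def Z_def p_def conv_def intro: le_less_trans)
  qed
  ultimately show ?thesis by (rule that)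
qed

section \<open>Topological group and completeness\<close>

abbreviation chars :: "('v \<Rightarrow> 'k) set" where
  "chars \<equiv> characters sm P mu one"

lemma topspace_chars: "topspace (subtopology ucp chars) = chars"
  by (simp add: topspace_ucp)

lemma continuous_conv:
  "continuous_map (prod_topology (subtopology ucp chars) (subtopology ucp chars))
     (subtopology ucp chars) (\<lambda>(f, g). conv Delta f g)"
proof (rule continuous_map_into_ucp)
  fix a assume "a \<in> topspace (prod_topology (subtopology ucp chars) (subtopology ucp chars))"
  then obtain f g where a: "a = (f, g)" and fg: "f \<in> chars" "g \<in> chars"
    by (auto simp: topspace_ucp)
  show "(case a of (f, g) \<Rightarrow> conv Delta f g) \<in> chars"
    using fg by (simp add: a conv_character)
  fix L and e :: real assume L: "precompact_lcs P L" and e: "e > 0"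
  obtain K where K: "precompact_lcs P K"
    "\<And>f' g' x. f' \<in> dual sm P \<Longrightarrow> g' \<in> dual sm P \<Longrightarrow> \<forall>x\<in>K. norm (f' x - f x) < 1 \<Longrightarrow>
      \<forall>x\<in>K. norm (g' x - g x) < 1 \<Longrightarrow> x \<in> L \<Longrightarrow> norm (conv Delta f' g' x - conv Delta f g x) < e"
    using conv_ucp_near[OF characterD(1)[OF fg(1)] characterD(1)[OF fg(2)] L e] by metis
  obtain U where U: "openin ucp U" "f \<in> U" "\<And>h x. h \<in> U \<Longrightarrow> x \<in> K \<Longrightarrow> norm (h x - f x) < 1"
    using ucp_open_ball[OF K(1) zero_less_one, of f] by metis
  obtain V where V: "openin ucp V" "g \<in> V" "\<And>h x. h \<in> V \<Longrightarrow> x \<in> K \<Longrightarrow> norm (h x - g x) < 1"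
    using ucp_open_ball[OF K(1) zero_less_one, of g] by metis
  let ?W = "(U \<inter> chars) \<times> (V \<inter> chars)"
  have "openin (prod_topology (subtopology ucp chars) (subtopology ucp chars)) ?W"
    using U V by (simp add: openin_prod_Times_iff openin_subtopology_Int)
  moreover have "a \<in> ?W" using U V fg a by simp
  moreover have "\<forall>b\<in>?W. \<forall>x\<in>L. norm ((case b of (f, g) \<Rightarrow> conv Delta f g) x
      - (case a of (f, g) \<Rightarrow> conv Delta f g) x) < e"
    using U(3) V(3) characterD(1) by (auto simp: a intro!: K(2))
  ultimately show "\<exists>W. openin (prod_topology (subtopology ucp chars) (subtopology ucp chars)) W \<and> a \<in> W \<and>
      (\<forall>b\<in>W. \<forall>x\<in>L. norm ((case b of (f, g) \<Rightarrow> conv Delta f g) x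
        - (case a of (f, g) \<Rightarrow> conv Delta f g) x) < e)" by blast
qed

lemma continuous_antipode:
  "continuous_map (subtopology ucp chars) (subtopology ucp chars) (\<lambda>w. w \<circ> S)"
proof (rule continuous_map_into_ucp)
  fix w assume "w \<in> topspace (subtopology ucp chars)"
  then have w: "w \<in> chars" by (simp add: topspace_ucp)
  then show "w \<circ> S \<in> chars" by (rule antipode_character)
  fix L and e :: real assume "precompact_lcs P L" and e: "e > 0"
  then have "precompact_lcs P (S ` L)" using precompact_image antipode_cont by blast
  then obtain U where U: "openin ucp U" "w \<in> U" "\<And>h x. h \<in> U \<Longrightarrow> x \<in> S ` L \<Longrightarrow> norm (h x - w x) < e"
    using ucp_open_ball[OF _ e, of "S ` L" w] by metis
  then show "\<exists>W. openin (subtopology ucp chars) W \<and> w \<in> W \<and>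
      (\<forall>b\<in>W. \<forall>x\<in>L. norm ((b \<circ> S) x - (w \<circ> S) x) < e)"
    using w by (intro exI[of _ "U \<inter> chars"]) (auto simp: openin_subtopology_Int)
qed

lemma characters_topological_group:
  "topological_group_on (subtopology ucp chars) (conv Delta) counit (\<lambda>w. w \<circ> S)"
  unfolding topological_group_on_def topspace_chars
  by (intro conjI continuous_conv continuous_antipode)
    (simp_all add: conv_character counit_character antipode_character conv_assoc conv_counit
      conv_antipode characterD(1))

lemma characters_complete: "ucp_complete_subset P chars"
  unfolding ucp_complete_subset_def
proof (intro allI impI, elim conjE)
  fix F :: "('v \<Rightarrow> 'k) filter"
  assume F: "F \<noteq> bot" and A: "eventually (\<lambda>f. f \<in> chars) F" and cauchy: "ucp_cauchy P F"
  have "\<forall>x. \<exists>l. ((\<lambda>f. f x) \<longlongrightarrow> l) F" using ucp_cauchy_pointwise_limit[OF F cauchy] by blast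
  then obtain w where w: "\<And>x. ((\<lambda>f. f x) \<longlongrightarrow> w x) F" by metis
  have conv: "ucp_converges P F w" using F cauchy w by (rule ucp_cauchy_converges)
  \<comment> \<open>Each defining identity holds eventually along \<open>F\<close>, so the limits of
    its two sides agree.\<close>
  have eq: "a = b" if "(h \<longlongrightarrow> a) F" "(k \<longlongrightarrow> b) F" "\<And>f. f \<in> chars \<Longrightarrow> h f = k f" for h k and a b :: 'k
  proof -
    have "eventually (\<lambda>f. h f = k f) F" using A by (rule eventually_mono) (rule that(3))
    then have "(k \<longlongrightarrow> a) F" using that(1) by (simp add: tendsto_cong)
    then show ?thesis using that(2) F tendsto_unique by blast
  qed
  have "w (x + y) = w x + w y" for x y
    by (rule eq[OF w tendsto_add[OF w w]]) (rule klinear_add[OF dual_klinear[OF characterD(1)]])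
  moreover have "w (sm a x) = a * w x" for a x
    by (rule eq[OF w tendsto_mult[OF tendsto_const w]]) (rule klinear_scale[OF dual_klinear[OF characterD(1)]])
  ultimately have "klinear sm w" by (simp add: klinear_def)
  moreover have "eventually (\<lambda>f. f \<in> dual sm P) F"
    using A by (rule eventually_mono) (rule characterD(1))
  ultimately have "w \<in> dual sm P" using ucp_limit_dual[OF F _ conv] by blast
  moreover have "w (mu x y) = w x * w y" for x y
    by (rule eq[OF w tendsto_mult[OF w w]]) (rule characterD(3))
  moreover have "w one = 1"
    by (rule eq[OF w tendsto_const]) (rule characterD(2))
  ultimately have "w \<in> chars" by (simp add: characters_def)
  then show "\<exists>w\<in>chars. ucp_converges P F w" using conv by blast
qed

end

section \<open>Involutive characters\<close>

locale eps_hopf_star = eps_hopf sm P mu one Delta counit S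
  for sm :: "complex \<Rightarrow> 'v::ab_group_add \<Rightarrow> 'v" and P :: "nat \<Rightarrow> 'v \<Rightarrow> real"
    and mu :: "'v \<Rightarrow> 'v \<Rightarrow> 'v" and one :: 'v and Delta :: "'v \<Rightarrow> (complex, 'v) bform"
    and counit :: "'v \<Rightarrow> complex" and S :: "'v \<Rightarrow> 'v" +
  fixes star :: "'v \<Rightarrow> 'v"
  assumes hopf_star: "eps_hopf_star_frechet sm P mu one Delta counit S star"
begin

lemma star_add [rule_format]: "\<forall>x y. star (x + y) = star x + star y"
  and star_scale [rule_format]: "\<forall>a x. star (sm a x) = sm (cnj a) (star x)"
  and star_star [rule_format]: "\<forall>x. star (star x) = x"
  and star_bound: "\<forall>M. \<exists>N C. \<forall>x. qsn P M (star x) \<le> C * qsn P N x"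
  and Delta_star [rule_format]: "\<forall>x. \<forall>f\<in>dual sm P. \<forall>g\<in>dual sm P.
    Delta (star x) f g = cnj (Delta x (\<lambda>a. cnj (f (star a))) (\<lambda>b. cnj (g (star b))))"
  by (insert hopf_star[unfolded eps_hopf_star_frechet_def], (elim conjE, assumption)+)

text \<open>The natural involution on the dual: it respects convolution by
  \<open>Delta_star\<close>, and its fixed points among the characters are the involutive
  ones.\<close>

definition adj :: "('v \<Rightarrow> complex) \<Rightarrow> 'v \<Rightarrow> complex" where
  "adj f = (\<lambda>x. cnj (f (star x)))"

lemma adj_adj: "adj (adj f) = f"
  by (simp add: adj_def star_star)

lemma adj_dual:
  assumes f: "f \<in> dual sm P" shows "adj f \<in> dual sm P"
proof -
  obtain n where n: "f \<in> equicont n" using f by (rule dual_equicont)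
  obtain N C where C: "\<And>x. qsn P n (star x) \<le> C * qsn P N x" using star_bound by blast
  have "norm (adj f x) \<le> (real n * C) * qsn P N x" for x
    using order_trans[OF equicontD(2)[OF n] mult_left_mono[OF C]] by (simp add: adj_def mult.assoc)
  moreover have "klinear sm (adj f)"
    using equicontD(1)[OF n] by (simp add: klinear_def adj_def star_add star_scale)
  ultimately show ?thesis using dualI by blast
qed

lemma adj_conv:
  assumes "f \<in> dual sm P" "g \<in> dual sm P"
  shows "adj (conv Delta f g) = conv Delta (adj f) (adj g)"
  unfolding adj_def conv_def using Delta_star[OF assms] by simp

text \<open>An involution preserving convolution maps the neutral element to a neutral element, and
  that is unique.\<close>

lemma adj_counit: "adj counit = counit"
proof -
  have "adj counit = conv Delta (adj counit) (adj (adj counit))"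
    by (simp add: adj_adj conv_counit adj_dual counit_dual)
  also have "\<dots> = adj (conv Delta counit (adj counit))"
    by (simp add: adj_conv adj_dual counit_dual)
  also have "\<dots> = counit" by (simp add: conv_counit adj_dual counit_dual adj_adj)
  finally show ?thesis .
qed

lemma inv_characters_eq: "inv_characters sm P mu one star = {w \<in> chars. adj w = w}"
proof -
  have "(\<forall>x. w (star x) = cnj (w x)) \<longleftrightarrow> adj w = w" for w
    unfolding adj_def fun_eq_iff by (metis complex_cnj_cnj)
  then show ?thesis by (simp add: inv_characters_def)
qed

text \<open>Since \<open>adj\<close> preserves convolution and fixes \<open>w\<close>, it turns the
  left inverse of \<open>w\<close> into a left inverse, which must equal the right inverse by
  associativity.\<close>

lemma adj_antipode:
  assumes w: "w \<in> chars" "adj w = w" shows "adj (w \<circ> S) = w \<circ> S"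
proof -
  note wd = characterD(1)[OF w(1)]
  note r = antipode_dual[OF wd]
  have "conv Delta (adj (w \<circ> S)) w = adj (conv Delta (w \<circ> S) w)"
    by (simp add: adj_conv r wd w)
  also have "\<dots> = counit" by (simp add: conv_antipode w adj_counit)
  finally have inv: "conv Delta (adj (w \<circ> S)) w = counit" .
  have "adj (w \<circ> S) = conv Delta (adj (w \<circ> S)) (conv Delta w (w \<circ> S))"
    by (simp add: conv_antipode w conv_counit adj_dual r)
  also have "\<dots> = conv Delta (conv Delta (adj (w \<circ> S)) w) (w \<circ> S)"
    by (simp add: conv_assoc adj_dual r wd)
  also have "\<dots> = w \<circ> S" unfolding inv by (rule conv_counit) (rule r)
  finally show ?thesis .
qed

text \<open>A violation at \<open>x\<close> persists under small changes of the values at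
  \<open>x\<close> and \<open>star x\<close>, and a two-point set is precompact.\<close>

lemma openin_not_involutive: "openin ucp {w. adj w \<noteq> w}"
  unfolding openin_ucp
proof
  fix w assume "w \<in> {w. adj w \<noteq> w}"
  then obtain x where x: "cnj (w (star x)) \<noteq> w x" by (auto simp: adj_def fun_eq_iff)
  define e where "e = norm (cnj (w (star x)) - w x) / 2"
  have "e > 0" using x by (simp add: e_def)
  have "adj g \<noteq> g" if g: "\<forall>y\<in>{x, star x}. norm (g y - w y) < e" for g
  proof
    assume "adj g = g"
    then have gx: "cnj (g (star x)) = g x" by (metis adj_def)
    have "cnj (w (star x)) - w x = (g x - w x) - cnj (g (star x) - w (star x))"
      using gx by simp
    then have "2 * e \<le> norm (g x - w x) + norm (cnj (g (star x) - w (star x)))"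
      unfolding e_def using norm_triangle_ineq4[of "g x - w x" "cnj (g (star x) - w (star x))"] by simp
    also have "\<dots> < 2 * e" using g unfolding complex_mod_cnj by simp
    finally show False by simp
  qed
  then have "{g. \<forall>y\<in>{x, star x}. norm (g y - w y) < e} \<subseteq> {w. adj w \<noteq> w}" by blast
  then show "\<exists>K e. precompact_lcs P K \<and> e > 0 \<and> {g. \<forall>y\<in>K. norm (g y - w y) < e} \<subseteq> {w. adj w \<noteq> w}"
    using \<open>e > 0\<close> precompact_finite[of "{x, star x}"] by blast
qed

lemma inv_characters_closed_subgroup:
  "closed_subgroup_of (subtopology ucp chars) (conv Delta) counit (\<lambda>w. w \<circ> S)
     (inv_characters sm P mu one star)"
proof -
  have "chars - {w \<in> chars. adj w = w} = {w. adj w \<noteq> w} \<inter> chars" by blast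
  then have "closedin (subtopology ucp chars) {w \<in> chars. adj w = w}"
    unfolding closedin_def topspace_chars by (auto simp: openin_subtopology_Int openin_not_involutive)
  then show ?thesis
    unfolding closed_subgroup_of_def inv_characters_eq topspace_chars
    by (auto simp: counit_character adj_counit conv_character adj_conv characterD(1)
        antipode_character adj_antipode)
qed

end

theorem theorem6p3:
  shows "(\<forall>(sm :: 'k::real_normed_field \<Rightarrow> 'v::ab_group_add \<Rightarrow> 'v) P mu one Delta counit S.
            eps_hopf_frechet sm P mu one Delta counit S \<longrightarrow>
              topological_group_on (subtopology (ucp_topology P) (characters sm P mu one))
                  (conv Delta) counit (\<lambda>w. w \<circ> S)
            \<and> ucp_complete_subset P (characters sm P mu one))
       \<and> (\<forall>(sm :: complex \<Rightarrow> 'w::ab_group_add \<Rightarrow> 'w) P mu one Delta counit S star.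
            eps_hopf_star_frechet sm P mu one Delta counit S star \<longrightarrow>
              closed_subgroup_of (subtopology (ucp_topology P) (characters sm P mu one))
                  (conv Delta) counit (\<lambda>w. w \<circ> S) (inv_characters sm P mu one star))"
proof (intro conjI allI impI)
  fix sm :: "'k \<Rightarrow> 'v \<Rightarrow> 'v" and P mu one Delta counit S
  assume "eps_hopf_frechet sm P mu one Delta counit S"
  then interpret eps_hopf sm P mu one Delta counit S by unfold_locales
  show "topological_group_on (subtopology (ucp_topology P) (characters sm P mu one))
      (conv Delta) counit (\<lambda>w. w \<circ> S)"
    by (rule characters_topological_group)
  show "ucp_complete_subset P (characters sm P mu one)"
    by (rule characters_complete)
next
  fix sm :: "complex \<Rightarrow> 'w \<Rightarrow> 'w" and P mu one Delta counit S star
  assume star: "eps_hopf_star_frechet sm P mu one Delta counit S star"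
  then have "eps_hopf_frechet sm P mu one Delta counit S"
    unfolding eps_hopf_star_frechet_def by (rule conjunct1)
  with star interpret eps_hopf_star sm P mu one Delta counit S star by unfold_locales
  show "closed_subgroup_of (subtopology (ucp_topology P) (characters sm P mu one))
      (conv Delta) counit (\<lambda>w. w \<circ> S) (inv_characters sm P mu one star)"
    by (rule inv_characters_closed_subgroup)
qed

end
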